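(* Let $\mathbb{X}$ be a Banach space with a basis of type P. If $\ell_2$ is isomorphic to a complemented subspace of $\mathbb{X}$, then $\mathbb{X}$ has an almost greedy basis $\mathcal{B}$ with $\phi_m[\mathcal{B}]\approx m^{1/2}$ for $m\in\mathbb{N}$ and $L_m[\mathcal{B}]\approx\log m$ for $m\ge2$.
   Context: Banach spaces are real or complex and bases are Schauder bases. A basis $(\mathbf{x}_j)_{j=1}^\infty$ is of type P if $\sup_k\|\sum_{j=1}^k\mathbf{x}_j\|<\infty$ and $\inf_j\|\mathbf{x}_j\|>0$. Let $\mathcal{B}=(\mathbf{x}_n)_{n=1}^\infty$ be a basis of $\mathbb{X}$ with coordinate functionals $(\mathbf{x}_n^* )_{n=1}^\infty$. For $A\subseteq\mathbb{N}$, the coordinate projection is $S_A[\mathcal{B}](f)=\sum_{n\in A}\mathbf{x}_n^*(f)\,\mathbf{x}_n$ (when well defined), and $\operatorname{supp}(f)=\{n:\mathbf{x}_n^*(f)\neq0\}$. The basis is almost greedy if there is a constant $C$ such that $\|f-S_A[\mathcal{B}](f)\|\le C\|f-S_B[\mathcal{B}](f)\|$ whenever $f\in\mathbb{X}$, $A,B\subseteq\mathbb{N}$, $|B|\le|A|<\infty$, and $|\mathbf{x}_j^*(f)|\le|\mathbf{x}_k^*(f)|$ for all $j\in\mathbb{N}\setminus A$ and $k\in A$. The fundamental function is $\phi_m[\mathcal{B}]=\sup_{|A|\le m}\|\sum_{j\in A}\mathbf{x}_j\|$. The w-conditionality constants are $$L_m[\mathcal{B}]=\sup\left\{\frac{\|S_A[\mathcal{B}](f)\|}{\|f\|}: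 f\ne0,\ \max(\operatorname{supp}(f))\le m,\ A\subseteq\mathbb{N}\right\}.$$ For families of nonnegative reals, $\alpha_i\lesssim\beta_i$ means there is a constant $C$ with $\alpha_i\le C\beta_i$ for all $i$, and $\alpha_i\approx\beta_i$ means $\alpha_i\lesssim\beta_i$ and $\beta_i\lesssim\alpha_i$. *)

theory Defs
  imports "HOL-Analysis.Analysis"
begin

text \<open>
  The notions below take the scalar multiplication as an explicit argument, so that they apply
  to real Banach spaces (with \<^const>\<open>scaleR\<close>) and to complex ones, for which the library has
  no type class. The following locale describes a Banach space over \<open>'k\<close>, to be used for \<open>'k\<close>
  the real or the complex numbers; the last axiom only says that the real vector space structure
  that comes with \<open>'a\<close> is the one obtained by restriction of scalars.
\<close>

locale banach_space_over = vector_space smul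
  for smul :: "'k::real_normed_field \<Rightarrow> 'a::banach \<Rightarrow> 'a" +
  assumes norm_smul: "norm (smul c f) = norm c * norm f"
    and smul_of_real: "smul (of_real r) f = r *\<^sub>R f"

lemma banach_space_over_scaleR: "banach_space_over (scaleR :: real \<Rightarrow> 'a::banach \<Rightarrow> 'a)"
  by unfold_locales (auto simp: scaleR_add_left scaleR_add_right)

text \<open>
  Bases are indexed from 0: \<open>x n\<close> is the basis vector with number \<open>n + 1\<close> in the usual
  enumeration by the positive integers.
\<close>

definition schauder_basis ::
  "('k::real_normed_field \<Rightarrow> 'a::real_normed_vector \<Rightarrow> 'a) \<Rightarrow> (nat \<Rightarrow> 'a) \<Rightarrow> bool" where
  "schauder_basis smul x \<longleftrightarrow> (\<forall>f. \<exists>!a. (\<lambda>n. smul (a n) (x n)) sums f)"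

definition coord ::
  "('k::real_normed_field \<Rightarrow> 'a::real_normed_vector \<Rightarrow> 'a) \<Rightarrow> (nat \<Rightarrow> 'a) \<Rightarrow> nat \<Rightarrow> 'a \<Rightarrow> 'k" where
  "coord smul x n f = (THE a. (\<lambda>n. smul (a n) (x n)) sums f) n"

definition basis_supp ::
  "('k::real_normed_field \<Rightarrow> 'a::real_normed_vector \<Rightarrow> 'a) \<Rightarrow> (nat \<Rightarrow> 'a) \<Rightarrow> 'a \<Rightarrow> nat set" where
  "basis_supp smul x f = {n. coord smul x n f \<noteq> 0}"

text \<open>
  The series may diverge when \<open>A\<close> and the support of \<open>f\<close> are both infinite. Below, the
  projection is only used for finite \<open>A\<close> or finitely supported \<open>f\<close>.
\<close>

definition coord_proj ::
  "('k::real_normed_field \<Rightarrow> 'a::real_normed_vector \<Rightarrow> 'a) \<Rightarrow> (nat \<Rightarrow> 'a) \<Rightarrow> nat set \<Rightarrow> 'a \<Rightarrow> 'a" where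
  "coord_proj smul x A f = (\<Sum>n. if n \<in> A then smul (coord smul x n f) (x n) else 0)"

definition type_P :: "(nat \<Rightarrow> 'a::real_normed_vector) \<Rightarrow> bool" where
  "type_P x \<longleftrightarrow> bdd_above (range (\<lambda>k. norm (\<Sum>j<k. x j))) \<and> (INF j. norm (x j)) > 0"

definition almost_greedy ::
  "('k::real_normed_field \<Rightarrow> 'a::real_normed_vector \<Rightarrow> 'a) \<Rightarrow> (nat \<Rightarrow> 'a) \<Rightarrow> bool" where
  "almost_greedy smul x \<longleftrightarrow>
     (\<exists>C. \<forall>f A B. finite A \<longrightarrow> finite B \<longrightarrow> card B \<le> card A \<longrightarrow>
        (\<forall>j k. j \<notin> A \<longrightarrow> k \<in> A \<longrightarrow> norm (coord smul x j f) \<le> norm (coord smul x k f)) \<longrightarrow>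
        norm (f - coord_proj smul x A f) \<le> C * norm (f - coord_proj smul x B f))"

text \<open>
  The suprema are taken in \<^typ>\<open>ennreal\<close>, so that they also make sense when they are infinite.
\<close>

definition fundamental_fun :: "(nat \<Rightarrow> 'a::real_normed_vector) \<Rightarrow> nat \<Rightarrow> ennreal" where
  "fundamental_fun x m = (SUP A \<in> {A. finite A \<and> card A \<le> m}. ennreal (norm (\<Sum>j\<in>A. x j)))"

text \<open>
  Because of the indexing from 0, the condition on the maximum of the support reads
  \<open>basis_supp smul x f \<subseteq> {..<m}\<close>.
\<close>

definition w_conditionality ::
  "('k::real_normed_field \<Rightarrow> 'a::real_normed_vector \<Rightarrow> 'a) \<Rightarrow> (nat \<Rightarrow> 'a) \<Rightarrow> nat \<Rightarrow> ennreal" where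
  "w_conditionality smul x m =
     (SUP (f, A) \<in> {f. f \<noteq> 0 \<and> basis_supp smul x f \<subseteq> {..<m}} \<times> UNIV.
        ennreal (norm (coord_proj smul x A f) / norm f))"

definition lesssim_on :: "'i set \<Rightarrow> ('i \<Rightarrow> ennreal) \<Rightarrow> ('i \<Rightarrow> ennreal) \<Rightarrow> bool" where
  "lesssim_on I \<alpha> \<beta> \<longleftrightarrow> (\<exists>C::real. \<forall>i\<in>I. \<alpha> i \<le> ennreal C * \<beta> i)"

definition approx_on :: "'i set \<Rightarrow> ('i \<Rightarrow> ennreal) \<Rightarrow> ('i \<Rightarrow> ennreal) \<Rightarrow> bool" where
  "approx_on I \<alpha> \<beta> \<longleftrightarrow> lesssim_on I \<alpha> \<beta> \<and> lesssim_on I \<beta> \<alpha>"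

definition l2_seqs :: "(nat \<Rightarrow> 'k::real_normed_field) set" where
  "l2_seqs = {a. summable (\<lambda>n. (norm (a n))\<^sup>2)}"

definition l2_norm :: "(nat \<Rightarrow> 'k::real_normed_field) \<Rightarrow> real" where
  "l2_norm a = sqrt (\<Sum>n. (norm (a n))\<^sup>2)"

definition complemented_subspace ::
  "('k::real_normed_field \<Rightarrow> 'a::real_normed_vector \<Rightarrow> 'a) \<Rightarrow> 'a set \<Rightarrow> bool" where
  "complemented_subspace smul Y \<longleftrightarrow>
     (\<exists>P. bounded_linear P \<and> (\<forall>c f. P (smul c f) = smul c (P f)) \<and> P \<circ> P = P \<and> range P = Y)"

definition l2_isomorphic_to ::
  "('k::real_normed_field \<Rightarrow> 'a::real_normed_vector \<Rightarrow> 'a) \<Rightarrow> 'a set \<Rightarrow> bool" where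
  "l2_isomorphic_to smul Y \<longleftrightarrow>
     (\<exists>T. (\<forall>a\<in>l2_seqs. \<forall>b\<in>l2_seqs. T (\<lambda>n. a n + b n) = T a + T b) \<and>
          (\<forall>c. \<forall>a\<in>l2_seqs. T (\<lambda>n. c * a n) = smul c (T a)) \<and>
          bij_betw T l2_seqs Y \<and>
          (\<exists>C. \<forall>a\<in>l2_seqs. norm (T a) \<le> C * l2_norm a) \<and>
          (\<exists>C. \<forall>a\<in>l2_seqs. l2_norm a \<le> C * norm (T a)))"

end

theory Submission
  imports Defs
begin

text \<open>
  Let \<open>x\<close> be a basis of type P. On blocks \<open>[p, p + 2 N)\<close> of doubling length, alternate the partial sums
  of the first half and of the second half of the block and take successive differences. The result
  is a seminormalized basis \<open>g\<close> of the same space for which the sum over a block is bounded, while the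
  sum over every second index of the block has norm at least a multiple of \<open>N\<close>.

  Since \<open>\<ell>\<^sub>2\<close> is complemented in \<open>X\<close>, we have \<open>X \<cong> X \<oplus> \<ell>\<^sub>2\<close>, and on the right-hand side the construction
  of Dilworth, Kalton and Kutzarova applies: in the \<open>n\<close>-th dyadic block, \<open>g\<^sub>n\<close> and \<open>2\<^sup>n - 1\<close> unit
  vectors of \<open>\<ell>\<^sub>2\<close> are rotated by an orthogonal matrix whose first column is constant. Up to the factor
  \<open>2 ^ (- n / 2)\<close>, the average of the coefficients over the block is then the coefficient of \<open>g\<^sub>n\<close>, which is
  bounded by the norm of the vector, and the remainders lie in \<open>\<ell>\<^sub>2\<close>. The new basis is almost greedy
  because, beyond an index proportional to \<open>(\<parallel>f\<parallel> / t)\<^sup>2\<close>, coefficients of size \<open>t\<close> come from the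
  remainders, while finitely many coefficients of size at most \<open>t\<close> cost at most a multiple of \<open>t\<close> times
  the square root of their number. The first \<open>m\<close> vectors form about \<open>log m\<close> blocks, and projecting onto
  unions of blocks reproduces the conditionality of \<open>g\<close>, which is linear in the number of blocks.
\<close>

section \<open>Schauder bases with bounded coordinate projections\<close>

text \<open>The class \<open>euclidean_space\<close> covers the real and the complex numbers at
  once. It supplies completeness of the scalars, needed to sum series of coordinates, and an inner
  product inducing their norm, needed to see that a real orthogonal matrix acts isometrically on
  scalar sequences.\<close>

locale scalar_banach = banach_space_over smul
  for smul :: "'k::{real_normed_field,euclidean_space} \<Rightarrow> 'a::banach \<Rightarrow> 'a"
begin

sublocale smul: bounded_bilinear smul
proof
  show "smul (r *\<^sub>R a) b = r *\<^sub>R smul a b" for r a b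
    by (metis scale_scale scaleR_conv_of_real smul_of_real)
  show "smul a (r *\<^sub>R b) = r *\<^sub>R smul a b" for r a b
    by (metis scale_left_commute smul_of_real)
  show "\<exists>K. \<forall>a b. norm (smul a b) \<le> norm a * norm b * K"
    by (intro exI[of _ 1]) (simp add: norm_smul)
qed (simp_all add: scale_left_distrib scale_right_distrib)

text \<open>\<open>bounded_linear\<close> only asks for real linearity, so homogeneity over
  \<open>'k\<close> is a separate clause here and in \<open>bfun\<close>.\<close>

definition bop :: "('a \<Rightarrow> 'a) \<Rightarrow> bool" where
  "bop L \<longleftrightarrow> bounded_linear L \<and> (\<forall>c f. L (smul c f) = smul c (L f))"

definition bfun :: "('a \<Rightarrow> 'k) \<Rightarrow> bool" where
  "bfun \<phi> \<longleftrightarrow> bounded_linear \<phi> \<and> (\<forall>c f. \<phi> (smul c f) = c * \<phi> f)"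

lemma bopI:
  assumes "\<And>f g. L (f + g) = L f + L g" "\<And>c f. L (smul c f) = smul c (L f)"
    "\<And>f. norm (L f) \<le> K * norm f"
  shows "bop L"
  unfolding bop_def using assms
  by (auto intro!: bounded_linear_intro[where K = K] simp: mult.commute simp flip: smul_of_real)

lemma bfunI:
  assumes "\<And>f g. \<phi> (f + g) = \<phi> f + \<phi> g" "\<And>c f. \<phi> (smul c f) = c * \<phi> f"
    "\<And>f. norm (\<phi> f) \<le> K * norm f"
  shows "bfun \<phi>"
  unfolding bfun_def using assms
  by (auto intro!: bounded_linear_intro[where K = K]
      simp: mult.commute scaleR_conv_of_real simp flip: smul_of_real)

lemma bop_bl: "bop L \<Longrightarrow> bounded_linear L"
  and bop_smul: "bop L \<Longrightarrow> L (smul c f) = smul c (L f)"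
  by (auto simp: bop_def)

lemma bfun_bl: "bfun \<phi> \<Longrightarrow> bounded_linear \<phi>"
  and bfun_smul: "bfun \<phi> \<Longrightarrow> \<phi> (smul c f) = c * \<phi> f"
  by (auto simp: bfun_def)

lemma bop_lin:
  assumes "bop L"
  shows "L (f + g) = L f + L g" "L (f - g) = L f - L g" "L 0 = 0" "L (sum h S) = (\<Sum>i\<in>S. L (h i))"
  using bop_bl[OF assms]
  by (simp_all add: linear_simps linear_sum[OF bounded_linear.linear])

lemma bfun_lin:
  assumes "bfun \<phi>"
  shows "\<phi> (f + g) = \<phi> f + \<phi> g" "\<phi> (f - g) = \<phi> f - \<phi> g" "\<phi> 0 = 0" "\<phi> (sum h S) = (\<Sum>i\<in>S. \<phi> (h i))"
  using bfun_bl[OF assms]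
  by (simp_all add: linear_simps linear_sum[OF bounded_linear.linear])

lemma bop_pos_bound:
  assumes "bop L" obtains K where "K > 0" "\<And>f. norm (L f) \<le> K * norm f"
  using bounded_linear.pos_bounded[OF bop_bl[OF assms]] by (metis mult.commute)

lemma bfun_compose: "bfun \<phi> \<Longrightarrow> bop L \<Longrightarrow> bfun (\<lambda>f. \<phi> (L f))"
  unfolding bfun_def bop_def by (auto intro: bounded_linear_compose)

lemma bfun_add: "bfun \<phi> \<Longrightarrow> bfun \<psi> \<Longrightarrow> bfun (\<lambda>f. \<phi> f + \<psi> f)"
  unfolding bfun_def by (auto intro: bounded_linear_add simp: distrib_left)

lemma bfun_cmult: "bfun \<phi> \<Longrightarrow> bfun (\<lambda>f. r * \<phi> f)"
  unfolding bfun_def by (auto intro: bounded_linear_compose[OF bounded_linear_mult_right])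

lemma bfun_zero: "bfun (\<lambda>f. 0)"
  unfolding bfun_def by auto

lemma bfun_sum: "(\<And>i. i \<in> S \<Longrightarrow> bfun (\<phi> i)) \<Longrightarrow> bfun (\<lambda>f. \<Sum>i\<in>S. \<phi> i f)"
  by (induction S rule: infinite_finite_induct) (auto intro: bfun_add bfun_zero)

definition biorth :: "(nat \<Rightarrow> 'a) \<Rightarrow> (nat \<Rightarrow> 'a \<Rightarrow> 'k) \<Rightarrow> bool" where
  "biorth z c \<longleftrightarrow> (\<forall>k. bfun (c k)) \<and> (\<forall>i k. c i (z k) = (if i = k then 1 else 0))"

text \<open>The functionals and the bound on the partial sum projections are carried explicitly;
  \<open>bounded_basis_schauder\<close> recovers a Schauder basis and identifies \<open>c\<close>
  with its coordinates.\<close>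

definition bounded_basis :: "(nat \<Rightarrow> 'a) \<Rightarrow> (nat \<Rightarrow> 'a \<Rightarrow> 'k) \<Rightarrow> real \<Rightarrow> bool" where
  "bounded_basis z c K \<longleftrightarrow> biorth z c \<and>
     (\<forall>n f. norm (\<Sum>k<n. smul (c k f) (z k)) \<le> K * norm f) \<and>
     (\<forall>f. (\<lambda>k. smul (c k f) (z k)) sums f)"

lemma biorth_sum:
  assumes "biorth z c" "finite F"
  shows "c i (\<Sum>k\<in>F. smul (b k) (z k)) = (if i \<in> F then b i else 0)"
proof -
  have "c i (\<Sum>k\<in>F. smul (b k) (z k)) = (\<Sum>k\<in>F. b k * c i (z k))"
    using assms unfolding biorth_def by (simp add: bfun_lin bfun_smul)
  also have "\<dots> = (\<Sum>k\<in>F. if k = i then b k else 0)"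
    using assms unfolding biorth_def by (intro sum.cong) auto
  finally show ?thesis using assms by simp
qed

text \<open>One good index per tolerance is enough for convergence: for n at least m the projection
  S_n fixes S_m f, so the error at n is the error at m minus its image under S_n, which costs at
  most a factor 1 + |K|.\<close>

lemma bounded_basisI:
  assumes bi: "biorth z c"
    and bd: "\<And>n f. norm (\<Sum>k<n. smul (c k f) (z k)) \<le> K * norm f"
    and ap: "\<And>f e. e > 0 \<Longrightarrow> \<exists>n. norm ((\<Sum>k<n. smul (c k f) (z k)) - f) < e"
  shows "bounded_basis z c K"
proof -
  let ?S = "\<lambda>n f. \<Sum>k<n. smul (c k f) (z k)"
  have lin: "?S n (f - g) = ?S n f - ?S n g" for n f g
    using bi by (simp add: biorth_def bfun_lin smul.diff_left sum_subtractf)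
  have SS: "?S n (?S m f) = ?S m f" if "m \<le> n" for m n f
  proof -
    have "?S n (?S m f) = (\<Sum>k<n. if k \<in> {..<m} then smul (c k f) (z k) else 0)"
      by (intro sum.cong) (auto simp: biorth_sum[OF bi])
    also have "\<dots> = ?S m f" using that by (intro sum.mono_neutral_cong_right) auto
    finally show ?thesis .
  qed
  have "(\<lambda>k. smul (c k f) (z k)) sums f" for f
    unfolding sums_def
  proof (rule LIMSEQ_I)
    fix e :: real assume e: "e > 0"
      define e' where "e' = e / (1 + \<bar>K\<bar>)"
    have e': "e' > 0" "e' * (1 + \<bar>K\<bar>) = e" using e by (auto simp: e'_def)
    obtain m where m: "norm (?S m f - f) < e'" using ap[OF e'(1), of f] by auto
    have "norm (?S n f - f) < e" if "n \<ge> m" for n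
    proof -
      have "?S n f - f = (?S m f - f) - ?S n (?S m f - f)"
        by (simp only: lin SS[OF that]) simp
      also have "norm \<dots> \<le> norm (?S m f - f) + K * norm (?S m f - f)"
        by (rule order_trans[OF norm_triangle_ineq4]) (intro add_mono order_refl bd)
      also have "\<dots> \<le> norm (?S m f - f) * (1 + \<bar>K\<bar>)"
        by (simp add: algebra_simps mult_mono)
      also have "\<dots> < e" using m e'(2) by (metis abs_ge_zero add_pos_nonneg mult_strict_right_mono zero_less_one)
      finally show ?thesis .
    qed
    then show "\<exists>no. \<forall>n\<ge>no. norm ((\<Sum>i<n. smul (c i f) (z i)) - f) < e" by blast
  qed
  then show ?thesis using bi bd unfolding bounded_basis_def by blast
qed

lemma bounded_basis_unique:
  assumes "biorth z c" "(\<lambda>n. smul (a n) (z n)) sums f"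
  shows "a = (\<lambda>n. c n f)"
proof
  fix i
  have "bounded_linear (c i)" using assms by (auto simp: biorth_def bfun_def)
  from bounded_linear.sums[OF this assms(2)]
  have "(\<lambda>n. c i (smul (a n) (z n))) sums c i f" .
  moreover have "(\<lambda>n. c i (smul (a n) (z n))) = (\<lambda>n. if n = i then a n else 0)"
    using assms by (auto simp: biorth_def bfun_smul)
  ultimately show "a i = c i f" using sums_unique2 sums_single by metis
qed

lemma bounded_basis_schauder:
  assumes "bounded_basis z c K"
  shows "schauder_basis smul z" and "coord smul z n f = c n f"
proof -
  have bi: "biorth z c" and s: "(\<lambda>k. smul (c k f) (z k)) sums f" for f
    using assms by (auto simp: bounded_basis_def)
  show "schauder_basis smul z" unfolding schauder_basis_def
    by (intro allI ex1I[where a = "\<lambda>n. c n f" for f]) (rule s, erule bounded_basis_unique[OF bi])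
  have "(THE a. (\<lambda>n. smul (a n) (z n)) sums f) = (\<lambda>n. c n f)"
    by (rule the_equality) (rule s, erule bounded_basis_unique[OF bi])
  then show "coord smul z n f = c n f" by (simp add: coord_def)
qed

section \<open>Boundedness of the partial sums of a Schauder basis\<close>

lemma coord_sums:
  assumes "schauder_basis smul x"
  shows "(\<lambda>n. smul (coord smul x n f) (x n)) sums f"
proof -
  have "\<exists>!a. (\<lambda>n. smul (a n) (x n)) sums f" using assms by (auto simp: schauder_basis_def)
  from theI'[OF this] show ?thesis unfolding coord_def .
qed

lemma coord_eqI:
  assumes "schauder_basis smul x" "(\<lambda>n. smul (a n) (x n)) sums f"
  shows "coord smul x n f = a n"
  using assms coord_sums[OF assms(1), of f] unfolding schauder_basis_def by metis

lemma coord_add: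
  assumes "schauder_basis smul x"
  shows "coord smul x n (f + g) = coord smul x n f + coord smul x n g"
  using sums_add[OF coord_sums[OF assms, of f] coord_sums[OF assms, of g]]
  by (intro coord_eqI[OF assms]) (simp add: scale_left_distrib)

lemma coord_smul:
  assumes "schauder_basis smul x"
  shows "coord smul x n (smul r f) = r * coord smul x n f"
proof (rule coord_eqI[OF assms])
  have "(\<lambda>n. smul r (smul (coord smul x n f) (x n))) sums smul r f"
    by (intro bounded_linear.sums[OF smul.bounded_linear_right] coord_sums assms)
  then show "(\<lambda>n. smul (r * coord smul x n f) (x n)) sums smul r f" by simp
qed

lemma schauder_nonzero:
  assumes "schauder_basis smul x" shows "x n \<noteq> 0"
proof
  assume z: "x n = 0"
  have "(\<lambda>k. smul (if k = n then 1 else 0) (x k)) sums 0"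
    using z by (intro sums_0[THEN sums_cong[THEN iffD1, rotated]]) auto
  moreover have "(\<lambda>k. smul 0 (x k)) sums 0" by simp
  ultimately show False
    using coord_eqI[OF assms, of "\<lambda>k. if k = n then 1 else 0" 0 n] coord_eqI[OF assms, of "\<lambda>k. 0" 0 n]
    by simp
qed

lemma coord_biorth:
  assumes "schauder_basis smul x"
  shows "coord smul x i (x k) = (if i = k then 1 else 0)"
proof (rule coord_eqI[OF assms])
  have "(\<lambda>n. smul (if n = k then 1 else 0) (x n)) = (\<lambda>n. if n = k then x n else 0)" by auto
  then show "(\<lambda>n. smul (if n = k then 1 else 0) (x n)) sums x k"
    using sums_single[of k x] by simp
qed

lemma coord_minus:
  assumes "schauder_basis smul x"
  shows "coord smul x n (f - g) = coord smul x n f - coord smul x n g"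
  using coord_add[OF assms, of n "f - g" g] by simp

text \<open>The Baire half of the open mapping argument. The sets \<open>G K\<close> of vectors
  whose partial sums are all bounded by \<open>K\<close> cover the space, so the closure of one of
  them has interior points. Differences of its members approximate every vector of a small ball
  about 0, and scaling gives the claim.\<close>

lemma partial_sums_approx:
  assumes sb: "schauder_basis smul x"
  defines "S \<equiv> \<lambda>n f. \<Sum>k<n. smul (coord smul x k f) (x k)"
  shows "\<exists>K \<ge> 0. \<forall>f. \<exists>g. norm (f - g) \<le> norm f / 2 \<and> (\<forall>n. norm (S n g) \<le> K * norm f)"
proof -
  define G where "G = (\<lambda>K. {f. \<forall>n. norm (S n f) \<le> real K})"
  have Sd: "S n (f - g) = S n f - S n g" for n f g
    unfolding S_def by (simp add: coord_minus[OF sb] smul.diff_left sum_subtractf)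
  have SR: "S n (r *\<^sub>R f) = r *\<^sub>R S n f" for n r f
    unfolding S_def smul_of_real[symmetric] by (simp add: coord_smul[OF sb] scale_sum_right)
  have cov: "(\<Union>K. closure (G K)) = UNIV"
  proof -
    have "f \<in> (\<Union>K. G K)" for f
    proof -
      have "(\<lambda>n. S n f) \<longlonglongrightarrow> f" using coord_sums[OF sb, of f] by (simp add: sums_def S_def)
      then have "Bseq (\<lambda>n. S n f)" by (rule convergent_imp_Bseq[OF convergentI])
      then obtain K where "\<forall>n. norm (S n f) \<le> K" by (auto simp: Bseq_def)
      moreover obtain N :: nat where "K \<le> real N" using real_arch_simple by blast
      ultimately have "\<forall>n. norm (S n f) \<le> real N" by (meson order_trans)
      then show ?thesis by (auto simp: G_def)
    qed
    then show ?thesis using closure_subset by blast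
  qed
  have "\<exists>K. interior (closure (G K)) \<noteq> {}"
  proof (rule ccontr)
    assume "\<not> ?thesis"
    then have "euclidean interior_of \<Union>(range (\<lambda>K. closure (G K))) = ({} :: 'a set)"
      by (intro Baire_category_alt) (auto simp: completely_metrizable_space_euclidean)
    then show False using cov by simp
  qed
  then obtain K y where y: "y \<in> interior (closure (G K))" by auto
  then obtain r where r: "r > 0" "cball y r \<subseteq> closure (G K)" by (meson mem_interior_cball)
  \<comment> \<open>The vector \<open>h\<close> is half the difference of \<open>y + h\<close> and
    \<open>y - h\<close>; approximating both moves the ball from \<open>y\<close> to the origin
    without enlarging the bound \<open>K\<close>.\<close>
  have ap: "\<exists>g. norm (h - g) < e \<and> (\<forall>n. norm (S n g) \<le> real K)" if h: "norm h \<le> r" and e: "e > 0" for h e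
  proof -
    have "y + h \<in> closure (G K)" "y - h \<in> closure (G K)"
      using r(2) h by (auto simp: subset_iff dist_norm)
    then obtain g1 g2 where g: "g1 \<in> G K" "dist g1 (y + h) < e" "g2 \<in> G K" "dist g2 (y - h) < e"
      using e unfolding closure_approachable by meson
    define g where "g = (1/2) *\<^sub>R (g1 - g2)"
    have "h - g = (1/2) *\<^sub>R ((y + h - g1) - (y - h - g2))"
      by (simp add: g_def scaleR_diff_right algebra_simps scaleR_add_right flip: scaleR_add_left)
    also have "norm \<dots> \<le> (1/2) * (norm (y + h - g1) + norm (y - h - g2))"
      using norm_triangle_ineq4[of "y + h - g1" "y - h - g2"] by simp
    also have "\<dots> < e" using g by (simp add: dist_norm norm_minus_commute)
    finally have 1: "norm (h - g) < e" .
    have "norm (S n g) \<le> real K" for n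
    proof -
      have "norm (S n g) \<le> (1/2) * (norm (S n g1) + norm (S n g2))"
        unfolding g_def SR Sd using norm_triangle_ineq4[of "S n g1" "S n g2"] by simp
      also have "\<dots> \<le> real K" using g by (auto simp: G_def) (smt (verit))
      finally show ?thesis .
    qed
    with 1 show ?thesis by blast
  qed
  show ?thesis
  proof (intro exI[of _ "real K / r"] conjI allI)
    show "real K / r \<ge> 0" using r by simp
    fix f
    show "\<exists>g. norm (f - g) \<le> norm f / 2 \<and> (\<forall>n. norm (S n g) \<le> real K / r * norm f)"
    proof (cases "f = 0")
      case True
      have "S n 0 = 0" for n using Sd[of n 0 0] by simp
      then show ?thesis using True by (intro exI[of _ 0]) auto
    next
      case False
      define t where "t = norm f / r"
      have t: "t > 0" using False r by (simp add: t_def)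
      obtain g where g: "norm ((1/t) *\<^sub>R f - g) < r / 2" "\<forall>n. norm (S n g) \<le> real K"
        using ap[of "(1/t) *\<^sub>R f" "r/2"] r False by (auto simp: t_def)
      have "f - t *\<^sub>R g = t *\<^sub>R ((1/t) *\<^sub>R f - g)" using t by (simp add: scaleR_diff_right)
      then have "norm (f - t *\<^sub>R g) = t * norm ((1/t) *\<^sub>R f - g)" using t by simp
      also have "\<dots> \<le> t * (r/2)" using g t by (intro mult_left_mono) auto
      also have "\<dots> = norm f / 2" using r by (simp add: t_def)
      finally have "norm (f - t *\<^sub>R g) \<le> norm f / 2" .
      moreover have "norm (S n (t *\<^sub>R g)) \<le> real K / r * norm f" for n
      proof -
        have "norm (S n (t *\<^sub>R g)) = t * norm (S n g)" using t by (simp add: SR)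
        also have "\<dots> \<le> t * real K" using g t by (intro mult_left_mono) auto
        finally show ?thesis by (simp add: t_def mult.commute)
      qed
      ultimately show ?thesis by blast
    qed
  qed
qed

lemma geometric_tail: "(\<Sum>i\<in>{m..<n}. (1/2::real) ^ i) \<le> 2 * (1/2) ^ m"
proof (cases "m \<le> n")
  case True
  have "(\<Sum>i\<in>{m..<m+k}. (1/2::real) ^ i) = 2 * (1/2) ^ m - 2 * (1/2) ^ (m + k)" for k
    by (induction k) (auto simp: power_add)
  from this[of "n - m"] True show ?thesis by simp
qed auto

text \<open>The second half of the open mapping argument: iterating the approximation writes
  \<open>f\<close> as a series of vectors \<open>g i\<close> whose partial sums are bounded by a
  geometric sequence, uniformly in \<open>n\<close>. Adding up the coordinates of the
  \<open>g i\<close> gives an expansion with controlled partial sums, and uniqueness makes it the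
  expansion of \<open>f\<close>.\<close>

lemma schauder_partial_sums_bounded:
  assumes sb: "schauder_basis smul x"
  shows "\<exists>K. \<forall>n f. norm (\<Sum>k<n. smul (coord smul x k f) (x k)) \<le> K * norm f"
proof -
  define S where "S = (\<lambda>n f. \<Sum>k<n. smul (coord smul x k f) (x k))"
  let ?c = "coord smul x"
  obtain K where K: "K \<ge> 0" "\<And>f. \<exists>g. norm (f - g) \<le> norm f / 2 \<and> (\<forall>n. norm (S n g) \<le> K * norm f)"
    using partial_sums_approx[OF sb] unfolding S_def by blast
  then obtain \<gamma> where \<gamma>: "\<And>f. norm (f - \<gamma> f) \<le> norm f / 2" "\<And>f n. norm (S n (\<gamma> f)) \<le> K * norm f"
    by metis
  have bound: "norm (S n f) \<le> 2 * K * norm f" for n f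
  proof -
    \<comment> \<open>\<open>h i\<close> is the error left after \<open>i\<close> approximation
      steps.\<close>
    define h where "h = (\<lambda>i. ((\<lambda>h. h - \<gamma> h) ^^ i) f)"
    define g where "g = (\<lambda>i. \<gamma> (h i))"
    have h0: "h 0 = f" and hS: "h (Suc i) = h i - g i" for i by (simp_all add: h_def g_def)
    have hn: "norm (h i) \<le> (1/2)^i * norm f" for i
    proof (induction i)
      case (Suc i)
      then show ?case using \<gamma>(1)[of "h i"] by (simp add: hS g_def)
    qed (simp add: h0)
    have Sg: "norm (S n (g i)) \<le> K * norm f * (1/2)^i" for n i
    proof -
      have "norm (S n (g i)) \<le> K * norm (h i)" unfolding g_def by (rule \<gamma>(2))
      also have "\<dots> \<le> K * ((1/2)^i * norm f)" using hn K by (intro mult_left_mono) auto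
      finally show ?thesis by (simp add: algebra_simps)
    qed
    have sumg: "(\<Sum>i<m. g i) = f - h m" for m
      by (induction m) (auto simp: h0 hS)
    have cg: "norm (?c k (g i)) \<le> (2 * K * norm f / norm (x k)) * (1/2)^i" for k i
    proof -
      have "smul (?c k (g i)) (x k) = S (Suc k) (g i) - S k (g i)" by (simp add: S_def)
      then have "norm (?c k (g i)) * norm (x k) \<le> norm (S (Suc k) (g i)) + norm (S k (g i))"
        by (metis norm_smul norm_triangle_ineq4)
      also have "\<dots> \<le> 2 * K * norm f * (1/2)^i"
        using Sg[of "Suc k" i] Sg[of k i] by simp
      finally show ?thesis using schauder_nonzero[OF sb, of k] by (simp add: field_simps)
    qed
    have summ: "summable (\<lambda>i. ?c k (g i))" for k
      by (rule summable_comparison_test'[OF _ cg]) (intro summable_mult summable_geometric, simp)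
    define b where "b = (\<lambda>k. \<Sum>i. ?c k (g i))"
    define B where "B = (\<lambda>n. \<Sum>k<n. smul (b k) (x k))"
    have Bs: "(\<lambda>i. S n (g i)) sums B n" for n
      unfolding S_def B_def b_def
      by (intro sums_sum bounded_linear.sums[OF smul.bounded_linear_left] summable_sums summ)
    \<comment> \<open>The tail bound does not depend on \<open>n\<close>, so the limits in
      \<open>i\<close> and \<open>n\<close> can be interchanged; its case \<open>m = 0\<close> is
      the final estimate.\<close>
    have Bm: "norm (B n - (\<Sum>i<m. S n (g i))) \<le> 2 * K * norm f * (1/2)^m" for n m
    proof (rule tendsto_upperbound)
      show "(\<lambda>l. norm ((\<Sum>i<l. S n (g i)) - (\<Sum>i<m. S n (g i)))) \<longlonglongrightarrow> norm (B n - (\<Sum>i<m. S n (g i)))"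
        using Bs[of n] unfolding sums_def by (intro tendsto_intros)
      show "\<forall>\<^sub>F l in sequentially. norm ((\<Sum>i<l. S n (g i)) - (\<Sum>i<m. S n (g i))) \<le> 2 * K * norm f * (1/2)^m"
        using eventually_ge_at_top[of m]
      proof eventually_elim
        case (elim l)
        have "(\<Sum>i<l. S n (g i)) - (\<Sum>i<m. S n (g i)) = (\<Sum>i\<in>{m..<l}. S n (g i))"
          using elim by (simp add: sum_diff_nat_ivl flip: atLeast0LessThan)
        also have "norm \<dots> \<le> (\<Sum>i\<in>{m..<l}. K * norm f * (1/2)^i)"
          by (rule sum_norm_le) (rule Sg)
        also have "\<dots> = K * norm f * (\<Sum>i\<in>{m..<l}. (1/2)^i)" by (simp add: sum_distrib_left)
        also have "\<dots> \<le> K * norm f * (2 * (1/2)^m)"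
          using K by (intro mult_left_mono geometric_tail) auto
        finally show ?case by (simp add: algebra_simps)
      qed
    qed simp
    have Sfin: "S n (\<Sum>i<m. g i) = (\<Sum>i<m. S n (g i))" for n m
    proof (induction m)
      case 0 show ?case by (simp add: S_def coord_eqI[OF sb, of "\<lambda>_. 0"])
    next
      case (Suc m)
      then show ?case by (simp add: S_def coord_add[OF sb] smul.add_left sum.distrib)
    qed
    have "(\<lambda>k. smul (b k) (x k)) sums f"
      unfolding sums_def
    proof (rule LIMSEQ_I)
      fix e :: real assume e: "e > 0"
      have "(\<lambda>m. (2 * K + 1) * norm f * (1/2)^m) \<longlonglongrightarrow> (2 * K + 1) * norm f * 0"
        by (intro tendsto_intros LIMSEQ_realpow_zero) auto
      then have "\<forall>\<^sub>F m in sequentially. (2 * K + 1) * norm f * (1/2)^m < e / 2"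
        using e by (intro order_tendstoD(2)) auto
      then obtain m where m: "(2 * K + 1) * norm f * (1/2)^m < e / 2"
        by (auto simp: eventually_sequentially)
      have "(\<lambda>n. S n (\<Sum>i<m. g i)) \<longlonglongrightarrow> (\<Sum>i<m. g i)"
        using coord_sums[OF sb] by (simp add: sums_def S_def)
      then obtain N where N: "\<And>n. n \<ge> N \<Longrightarrow> norm (S n (\<Sum>i<m. g i) - (\<Sum>i<m. g i)) < e / 2"
        using LIMSEQ_D[of _ _ "e/2"] e by (metis half_gt_zero)
      have "norm (B n - f) < e" if n: "n \<ge> N" for n
      proof -
        have "B n - f = (B n - (\<Sum>i<m. S n (g i))) + (S n (\<Sum>i<m. g i) - (\<Sum>i<m. g i)) - h m"
          using sumg[of m] by (simp add: Sfin algebra_simps)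
        also have "norm \<dots> \<le> norm (B n - (\<Sum>i<m. S n (g i))) + norm (S n (\<Sum>i<m. g i) - (\<Sum>i<m. g i)) + norm (h m)"
          by (meson norm_triangle_ineq norm_triangle_ineq4 order_trans add_right_mono)
        also have "\<dots> < 2 * K * norm f * (1/2)^m + e/2 + (1/2)^m * norm f"
          using Bm[of n m] N[OF n] hn[of m] by linarith
        also have "\<dots> < e" using m by (simp add: algebra_simps)
        finally show ?thesis .
      qed
      then show "\<exists>no. \<forall>n\<ge>no. norm ((\<Sum>i<n. smul (b i) (x i)) - f) < e" by (auto simp: B_def)
    qed
    then have "S n f = B n" for n unfolding S_def B_def by (simp add: coord_eqI[OF sb])
    then show ?thesis using Bm[of n 0] by simp
  qed
  then show ?thesis unfolding S_def by blast
qed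

lemma coord_bounded:
  assumes sb: "schauder_basis smul x"
    and K: "\<And>n f. norm (\<Sum>k<n. smul (coord smul x k f) (x k)) \<le> K * norm f"
  shows "norm (coord smul x n f) \<le> 2 * K / norm (x n) * norm f"
proof -
  let ?S = "\<lambda>n. \<Sum>k<n. smul (coord smul x k f) (x k)"
  have "smul (coord smul x n f) (x n) = ?S (Suc n) - ?S n" by simp
  then have "norm (coord smul x n f) * norm (x n) \<le> norm (?S (Suc n)) + norm (?S n)"
    by (metis norm_smul norm_triangle_ineq4)
  also have "\<dots> \<le> 2 * K * norm f" using K[where n = "Suc n" and f = f] K[where n = n and f = f] by linarith
  finally show ?thesis using schauder_nonzero[OF sb, of n] by (simp add: field_simps)
qed

theorem schauder_bounded_basis:
  assumes sb: "schauder_basis smul x"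
  shows "\<exists>K. bounded_basis x (coord smul x) K"
proof -
  obtain K where K: "\<And>n f. norm (\<Sum>k<n. smul (coord smul x k f) (x k)) \<le> K * norm f"
    using schauder_partial_sums_bounded[OF sb] by blast
  have "bfun (coord smul x n)" for n
    by (rule bfunI[OF coord_add[OF sb] coord_smul[OF sb] coord_bounded[OF sb K]])
  then have "biorth x (coord smul x)" using coord_biorth[OF sb] by (simp add: biorth_def)
  then show ?thesis using K coord_sums[OF sb] unfolding bounded_basis_def by blast
qed

end

section \<open>A sufficient condition for almost greediness\<close>

lemma L2_set_subset_le:
  assumes "finite B" "A \<subseteq> B"
  shows "L2_set f A \<le> L2_set f B"
  unfolding L2_set_def using assms by (auto intro!: sum_mono2)

text \<open>Add the elements in increasing order. The new element \<open>b\<close> is at least the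
  number k of earlier ones, and 1 / sqrt (k + 1) is at most 2 (sqrt (k + 1) - sqrt k), which
  telescopes.\<close>

lemma sum_inverse_sqrt_le:
  assumes "finite F"
  shows "(\<Sum>j\<in>F. 1 / sqrt (real j + 1)) \<le> 2 * sqrt (real (card F))"
  using assms
proof (induction F rule: finite_linorder_max_induct)
  case (insert b A)
  have "A \<subseteq> {..<b}" using insert by auto
  from card_mono[OF _ this] have cb: "card A \<le> b" by simp
  define u where "u = sqrt (real (card A))"
  define v where "v = sqrt (real (card A) + 1)"
  have v: "v > 0" "u \<ge> 0" "u \<le> v" by (simp_all add: u_def v_def add_pos_nonneg add_nonneg_pos)
  have "1 = (v - u) * (v + u)" by (simp add: u_def v_def algebra_simps)
  also have "\<dots> \<le> (v - u) * (2 * v)" using v by (intro mult_left_mono) auto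
  finally have "1 / v \<le> 2 * (v - u)" using v by (simp add: field_simps)
  moreover have "1 / sqrt (real b + 1) \<le> 1 / v"
    using cb v unfolding v_def by (intro divide_left_mono) auto
  ultimately show ?case using insert by (auto simp: u_def v_def add.commute)
qed simp

lemma sum_inverse_le_ln:
  assumes "m \<ge> 1"
  shows "(\<Sum>j<m. 1 / (real j + 1)) \<le> 1 + ln (real m)"
proof -
  obtain k where k: "m = Suc k" using assms by (cases m) auto
  have "(\<Sum>j<m. 1 / (real j + 1)) = harm m"
    by (simp add: harm_altdef inverse_eq_divide add.commute)
  moreover have "harm (Suc k) - ln (real (Suc k)) \<le> harm (Suc 0) - ln (real (Suc 0))"
    using decseq_harm_diff_ln unfolding decseq_def by (metis le0)
  ultimately show ?thesis by (simp add: k harm_expand)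
qed

text \<open>The properties that will make the rotated basis greedy: a coefficient
  \<open>c j f\<close> is an average of order (j + 1) ^ (-1/2) plus a remainder
  \<open>r j f\<close>, the remainders satisfy a Bessel inequality, and synthesis costs a weighted
  l1 norm plus an l2 norm. The basis property is kept apart, since \<open>projection_bound\<close>
  enters its proof.\<close>

locale dkk_estimates = scalar_banach smul
  for smul :: "'k::{real_normed_field,euclidean_space} \<Rightarrow> 'a::banach \<Rightarrow> 'a" +
  fixes z :: "nat \<Rightarrow> 'a" and c r :: "nat \<Rightarrow> 'a \<Rightarrow> 'k" and C :: real
  assumes C1: "C \<ge> 1"
    and upper: "finite F \<Longrightarrow> norm (\<Sum>j\<in>F. smul (b j) (z j)) \<le>
        C * ((\<Sum>j\<in>F. norm (b j) / sqrt (real j + 1)) + L2_set (\<lambda>j. norm (b j)) F)"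
    and average: "norm (c j f - r j f) \<le> C * norm f / sqrt (real j + 1)"
    and bessel: "finite F \<Longrightarrow> L2_set (\<lambda>j. norm (r j f)) F \<le> C * norm f"
begin

text \<open>The factor 3 is 2 from \<open>sum_inverse_sqrt_le\<close> for the weighted l1 part and 1
  for the l2 part.\<close>

lemma bounded_coeffs:
  assumes "finite F" "\<And>j. j \<in> F \<Longrightarrow> norm (b j) \<le> t" "t \<ge> 0"
  shows "norm (\<Sum>j\<in>F. smul (b j) (z j)) \<le> 3 * C * t * sqrt (real (card F))"
proof -
  have "(\<Sum>j\<in>F. norm (b j) / sqrt (real j + 1)) \<le> (\<Sum>j\<in>F. t * (1 / sqrt (real j + 1)))"
    using assms by (intro sum_mono) (auto intro!: divide_right_mono)
  also have "\<dots> \<le> t * (2 * sqrt (real (card F)))"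
    unfolding sum_distrib_left[symmetric] using assms by (intro mult_left_mono sum_inverse_sqrt_le)
  finally have 1: "(\<Sum>j\<in>F. norm (b j) / sqrt (real j + 1)) \<le> 2 * t * sqrt (real (card F))" by simp
  have "L2_set (\<lambda>j. norm (b j)) F \<le> L2_set (\<lambda>j. t) F"
    using assms by (intro L2_set_mono) auto
  also have "\<dots> = t * sqrt (real (card F))" using assms by (simp add: L2_set_constant)
  finally have "norm (\<Sum>j\<in>F. smul (b j) (z j)) \<le> C * (2 * t * sqrt (real (card F)) + t * sqrt (real (card F)))"
    using C1 1 by (intro order_trans[OF upper[OF assms(1)]] mult_left_mono add_mono) auto
  then show ?thesis by (simp add: algebra_simps)
qed

text \<open>Beyond the index \<open>(2 C \<parallel>f\<parallel> / t)\<^sup>2\<close> the averages are at most \<open>t / 2\<close>, so that a large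
  coefficient has a large remainder there.\<close>

lemma large_remainder:
  assumes "t > 0" "norm (c j f) \<ge> t" "(2 * C * norm f / t)\<^sup>2 \<le> real j + 1"
  shows "norm (r j f) \<ge> t / 2" "norm (c j f) \<le> 2 * norm (r j f)"
proof -
  have "2 * C * norm f / t \<le> sqrt (real j + 1)" using assms(3) by (simp add: real_le_rsqrt)
  then have "C * norm f / sqrt (real j + 1) \<le> t / 2"
    using assms(1) by (simp add: field_simps add_pos_nonneg add_nonneg_pos)
  then have "norm (c j f - r j f) \<le> t / 2" using average[of j f] by linarith
  moreover have "norm (c j f) - norm (r j f) \<le> norm (c j f - r j f)" by (rule norm_triangle_ineq2)
  ultimately show "norm (r j f) \<ge> t / 2" "norm (c j f) \<le> 2 * norm (r j f)"
    using assms(2) by linarith+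
qed

text \<open>At most \<open>X\<close> indices lie below the cutoff \<open>X\<close> of
  \<open>large_remainder\<close>; beyond it every remainder is at least t / 2, and the Bessel
  inequality allows at most \<open>X\<close> of those.\<close>

lemma large_coeffs:
  assumes fin: "finite G" and t: "t > 0" and big: "\<And>j. j \<in> G \<Longrightarrow> norm (c j f) \<ge> t"
  shows "t * sqrt (real (card G)) \<le> 3 * C * norm f"
proof -
  define X where "X = (2 * C * norm f / t)\<^sup>2"
  define G1 where "G1 = {j \<in> G. real j + 1 < X}"
  have X0: "X \<ge> 0" by (simp add: X_def)
  have "G1 \<subseteq> {..<nat \<lfloor>X\<rfloor>}" unfolding G1_def
    by (auto simp: zless_nat_eq_int_zless) linarith
  then have "card G1 \<le> nat \<lfloor>X\<rfloor>" by (metis card_lessThan card_mono finite_lessThan)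
  then have c1: "real (card G1) \<le> X" using X0 by linarith
  have "real (card (G - G1)) * (t / 2)\<^sup>2 = (\<Sum>j\<in>G - G1. (t / 2)\<^sup>2)" by simp
  also have "\<dots> \<le> (\<Sum>j\<in>G - G1. (norm (r j f))\<^sup>2)"
    using large_remainder(1)[OF t big] t by (intro sum_mono power_mono) (auto simp: G1_def X_def)
  also have "\<dots> = (L2_set (\<lambda>j. norm (r j f)) (G - G1))\<^sup>2"
    by (simp add: L2_set_def sum_nonneg)
  also have "\<dots> \<le> (C * norm f)\<^sup>2" using fin by (intro power_mono bessel) auto
  finally have c2: "real (card (G - G1)) \<le> X" using t
    by (simp add: X_def field_simps power2_eq_square)
  have "card G = card G1 + card (G - G1)" using fin
    by (metis (no_types, lifting) G1_def card_Diff_subset card_mono finite_Collect_conjI finite_subset le_add_diff_inverse mem_Collect_eq subsetI)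
  then have "real (card G) \<le> 2 * X" using c1 c2 by linarith
  \<comment> \<open>The total 2 X is 8 (C norm f / t)^2, rounded up to the perfect square with
    factor 9.\<close>
  also have "\<dots> \<le> (3 * C * norm f / t)\<^sup>2"
    using t by (simp add: X_def power_mult_distrib power_divide divide_right_mono mult_right_mono)
  finally have "sqrt (real (card G)) \<le> 3 * C * norm f / t" using t C1 by (intro real_le_lsqrt) auto
  then show ?thesis using t by (simp add: field_simps)
qed

text \<open>The averages have l2 norm at most \<open>C * norm f * s\<close>, where the square of
  \<open>s\<close> is the harmonic sum over \<open>F\<close>; Cauchy-Schwarz bounds the weighted l1
  part with one more factor \<open>s\<close>. The harmonic sum is of order log m over
  \<open>{..<m}\<close> and bounded within one dyadic block.\<close>

lemma projection_bound:
  assumes fin: "finite F"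
  shows "norm (\<Sum>j\<in>F. smul (c j f) (z j)) \<le> 2 * C\<^sup>2 * (1 + (\<Sum>j\<in>F. 1 / (real j + 1))) * norm f"
proof -
  define s where "s = L2_set (\<lambda>j. 1 / sqrt (real j + 1)) F"
  have s2: "s\<^sup>2 = (\<Sum>j\<in>F. 1 / (real j + 1))"
    by (simp add: s_def L2_set_def power_divide sum_nonneg)
  have s0: "s \<ge> 0" by (simp add: s_def)
  let ?l = "L2_set (\<lambda>j. norm (c j f)) F"
  have "?l \<le> L2_set (\<lambda>j. norm (c j f - r j f) + norm (r j f)) F"
    by (intro L2_set_mono) (metis add.commute norm_triangle_sub, simp)
  also have "\<dots> \<le> L2_set (\<lambda>j. norm (c j f - r j f)) F + L2_set (\<lambda>j. norm (r j f)) F"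
    by (rule L2_set_triangle_ineq)
  also have "\<dots> \<le> L2_set (\<lambda>j. C * norm f * (1 / sqrt (real j + 1))) F + C * norm f"
    using average by (intro add_mono L2_set_mono bessel fin) auto
  also have "L2_set (\<lambda>j. C * norm f * (1 / sqrt (real j + 1))) F = C * norm f * s"
    unfolding s_def using C1 by (subst L2_set_right_distrib) auto
  finally have l: "?l \<le> C * norm f * (1 + s)" by (simp add: algebra_simps)
  have "(\<Sum>j\<in>F. norm (c j f) / sqrt (real j + 1)) \<le> ?l * s"
    using L2_set_mult_ineq[of "\<lambda>j. norm (c j f)" "\<lambda>j. 1 / sqrt (real j + 1)" F] by (simp add: s_def)
  then have "norm (\<Sum>j\<in>F. smul (c j f) (z j)) \<le> C * (?l * s + ?l)"
    using C1 by (intro order_trans[OF upper[OF fin]] mult_left_mono add_mono) auto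
  also have "\<dots> = C * (1 + s) * ?l" by (simp add: algebra_simps)
  also have "\<dots> \<le> C * (1 + s) * (C * norm f * (1 + s))"
    using l C1 s0 by (intro mult_left_mono) auto
  also have "\<dots> = C\<^sup>2 * norm f * (1 + s)\<^sup>2" by (simp add: power2_eq_square algebra_simps)
  also have "\<dots> \<le> C\<^sup>2 * norm f * (2 * (1 + s\<^sup>2))"
    using sum_squares_bound[of 1 s] by (intro mult_left_mono) (auto simp: power2_sum)
  finally show ?thesis by (simp add: s2 algebra_simps)
qed

end

section \<open>Almost greediness, fundamental function and the upper bound for
  conditionality\<close>

locale dkk_basis = dkk_estimates +
  assumes basis: "bounded_basis z c C"
begin

lemma biorth: "biorth z c" using basis by (simp add: bounded_basis_def)

lemma coord_eq: "coord smul z n f = c n f"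
  by (rule bounded_basis_schauder(2)[OF basis])

lemma eq_zeroI:
  assumes "\<And>j. c j f = 0" shows "f = 0"
proof -
  have "(\<lambda>k. smul (c k f) (z k)) sums f" using basis by (auto simp: bounded_basis_def)
  then show ?thesis using assms by (simp add: sums_iff)
qed

lemma coord_proj_finite:
  assumes "finite F" "\<And>j. j \<in> A \<Longrightarrow> j \<notin> F \<Longrightarrow> c j f = 0" "F \<subseteq> A"
  shows "coord_proj smul z A f = (\<Sum>j\<in>F. smul (c j f) (z j))"
proof -
  have "coord_proj smul z A f = (\<Sum>j\<in>F. if j \<in> A then smul (c j f) (z j) else 0)"
    unfolding coord_proj_def coord_eq using assms by (intro suminf_finite) auto
  also have "\<dots> = (\<Sum>j\<in>F. smul (c j f) (z j))" using assms by (intro sum.cong) auto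
  finally show ?thesis .
qed

text \<open>Cut at the index \<open>m\<close> near R^2. Below the cut, the part in \<open>A\<close>
  is a partial sum minus the part outside \<open>A\<close>; the latter has at most R^2 coefficients
  of size at most \<open>t\<close> and costs a multiple of t R, hence of \<open>norm f\<close>.
  Above the cut the coefficients in \<open>A\<close> are dominated by their remainders.\<close>

lemma greedy_projection_bound:
  assumes fin: "finite A" and t: "t > 0" and big: "\<And>j. j \<in> A \<Longrightarrow> norm (c j f) \<ge> t"
    and small: "\<And>j. j \<notin> A \<Longrightarrow> norm (c j f) \<le> t"
  shows "norm (\<Sum>j\<in>A. smul (c j f) (z j)) \<le> 11 * C\<^sup>2 * norm f"
proof (cases "f = 0")
  case True
  have "c j 0 = 0" for j using biorth by (simp add: biorth_def bfun_lin)
  then show ?thesis using True by simp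
next
  case False
  define K where "K = norm f"
  have K: "K > 0" "C * K > 0" using False C1 by (auto simp: K_def)
  define R where "R = 2 * C * K / t"
  have R: "R > 0" using K C1 t by (simp add: R_def)
  define m where "m = nat \<lfloor>R\<^sup>2\<rfloor>"
  have m: "real m \<le> R\<^sup>2" by (simp add: m_def)
  define T where "T = A - {..<m}"
  have fT: "finite T" using fin by (simp add: T_def)
  have gt: "R\<^sup>2 \<le> real j + 1" if "j \<in> T" for j
    using that unfolding T_def m_def by auto linarith
  have rem: "norm (r j f) \<ge> t / 2" "norm (c j f) \<le> 2 * norm (r j f)" if "j \<in> T" for j
    using large_remainder[OF t big[of j]] gt[OF that] that by (auto simp: T_def R_def K_def)
  let ?z = "\<lambda>F. \<Sum>j\<in>F. smul (c j f) (z j)"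
  have split: "?z A = ?z T + ?z {..<m} - ?z ({..<m} - A)"
  proof -
    have "?z A = ?z T + ?z (A \<inter> {..<m})"
      unfolding T_def using sum.Int_Diff[OF fin, where B = "{..<m}"] by (simp add: add.commute)
    moreover have "?z {..<m} = ?z (A \<inter> {..<m}) + ?z ({..<m} - A)"
      using sum.Int_Diff[of "{..<m}", where B = A] by (simp add: Int_commute)
    ultimately show ?thesis by simp
  qed
  have 1: "norm (?z {..<m}) \<le> C * K" using basis by (auto simp: bounded_basis_def K_def)
  have "norm (?z ({..<m} - A)) \<le> 3 * C * t * sqrt (real (card ({..<m} - A)))"
    using small t by (intro bounded_coeffs) auto
  also have "\<dots> \<le> 3 * C * t * R"
  proof -
    have "card ({..<m} - A) \<le> m" by (metis card_lessThan card_mono finite_lessThan Diff_subset)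
    then have "real (card ({..<m} - A)) \<le> R\<^sup>2" using m by linarith
    then have "sqrt (real (card ({..<m} - A))) \<le> R" using R by (intro real_le_lsqrt) auto
    then show ?thesis using C1 t by (intro mult_left_mono) auto
  qed
  also have "\<dots> = 6 * C\<^sup>2 * K" using t by (simp add: R_def power2_eq_square)
  finally have 2: "norm (?z ({..<m} - A)) \<le> 6 * C\<^sup>2 * K" .
  have r2: "(\<Sum>j\<in>T. (norm (r j f))\<^sup>2) \<le> (C * K)\<^sup>2"
  proof -
    have "(\<Sum>j\<in>T. (norm (r j f))\<^sup>2) = (L2_set (\<lambda>j. norm (r j f)) T)\<^sup>2" by (simp add: L2_set_def sum_nonneg)
    also have "\<dots> \<le> (C * K)\<^sup>2" unfolding K_def by (intro power_mono bessel fT) auto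
    finally show ?thesis .
  qed
  have "L2_set (\<lambda>j. norm (c j f)) T \<le> L2_set (\<lambda>j. 2 * norm (r j f)) T"
    using rem by (intro L2_set_mono) auto
  also have "\<dots> = 2 * L2_set (\<lambda>j. norm (r j f)) T" by (simp add: L2_set_right_distrib)
  also have "\<dots> \<le> 2 * (C * K)" unfolding K_def using bessel[OF fT, of f] by simp
  finally have 3: "L2_set (\<lambda>j. norm (c j f)) T \<le> 2 * (C * K)" .
  \<comment> \<open>A linear term becomes a square, to which Bessel applies: sqrt (j + 1) is at
    least \<open>R\<close>, and the factor \<open>t\<close> in 1 / R is absorbed by t <= 2 norm (r j
    f).\<close>
  have "(\<Sum>j\<in>T. norm (c j f) / sqrt (real j + 1)) \<le> (\<Sum>j\<in>T. (2 / (C * K)) * (norm (r j f))\<^sup>2)"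
  proof (rule sum_mono)
    fix j assume j: "j \<in> T"
    have sq: "R \<le> sqrt (real j + 1)" using gt[OF j] by (simp add: real_le_rsqrt)
    have "norm (c j f) / sqrt (real j + 1) \<le> 2 * norm (r j f) / R"
      using rem[OF j] sq R by (intro frac_le) auto
    also have "\<dots> = norm (r j f) * t / (C * K)" by (simp add: R_def)
    also have "\<dots> \<le> norm (r j f) * (2 * norm (r j f)) / (C * K)"
      using rem[OF j] K by (intro divide_right_mono mult_left_mono) auto
    finally show "norm (c j f) / sqrt (real j + 1) \<le> (2 / (C * K)) * (norm (r j f))\<^sup>2"
      by (simp add: power2_eq_square mult_ac)
  qed
  also have "\<dots> \<le> (2 / (C * K)) * (C * K)\<^sup>2"
    unfolding sum_distrib_left[symmetric] using r2 K by (intro mult_left_mono) auto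
  also have "\<dots> = 2 * (C * K)" using K by (simp add: power2_eq_square)
  finally have "norm (?z T) \<le> C * (2 * (C * K) + 2 * (C * K))"
    using 3 C1 by (intro order_trans[OF upper[OF fT]] mult_left_mono add_mono) auto
  then have 4: "norm (?z T) \<le> 4 * C\<^sup>2 * K" by (simp add: power2_eq_square)
  have "norm (?z A) \<le> norm (?z T) + norm (?z {..<m}) + norm (?z ({..<m} - A))"
    unfolding split by (meson norm_triangle_ineq norm_triangle_ineq4 order_trans add_right_mono)
  \<comment> \<open>The 4 comes from beyond the cut, the 1 from the partial sum, the 6 from the
    small coefficients.\<close>
  also have "\<dots> \<le> 4 * C\<^sup>2 * K + C\<^sup>2 * K + 6 * C\<^sup>2 * K"
  proof -
    have "C * K \<le> C\<^sup>2 * K" using C1 K by (simp add: power2_eq_square)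
    then show ?thesis using 1 2 4 by linarith
  qed
  finally show ?thesis by (simp add: K_def mult_ac)
qed

text \<open>With \<open>g\<close> the error for \<open>B\<close>, the error for \<open>A\<close> is
  \<open>g\<close> minus its projection to \<open>A - B\<close>, plus the projection of
  \<open>f\<close> to \<open>B - A\<close>. The set \<open>A - B\<close> is greedy for
  \<open>g\<close>; and \<open>B - A\<close> has at most as many elements, with coefficients of size
  at most \<open>t\<close>, as \<open>A - B\<close> has with coefficients of size at least
  \<open>t\<close>. The constant is 21 = 1 + 11 + 9.\<close>

theorem almost_greedy: "almost_greedy smul z"
  unfolding almost_greedy_def
proof (intro exI[of _ "21 * C\<^sup>2"] allI impI)
  fix f and A B :: "nat set"
  assume A: "finite A" and B: "finite B" and card: "card B \<le> card A"
    and gr: "\<forall>j k. j \<notin> A \<longrightarrow> k \<in> A \<longrightarrow> norm (coord smul z j f) \<le> norm (coord smul z k f)"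
  let ?z = "\<lambda>F. \<Sum>j\<in>F. smul (c j f) (z j)"
  have PA: "coord_proj smul z A f = ?z A" and PB: "coord_proj smul z B f = ?z B"
    using A B by (auto intro: coord_proj_finite)
  define g where "g = f - ?z B"
  have lin: "c j (f - h) = c j f - c j h" for j h using biorth by (simp add: biorth_def bfun_lin)
  have cg: "c j g = (if j \<in> B then 0 else c j f)" for j
    by (simp add: g_def lin biorth_sum[OF biorth B])
  have one: "1 \<le> C\<^sup>2" using C1 by simp
  show "norm (f - coord_proj smul z A f) \<le> 21 * C\<^sup>2 * norm (f - coord_proj smul z B f)"
  proof (cases "A = {}")
    case True
    then have "B = {}" using card B by simp
    then show ?thesis using True one mult_right_mono[of 1 "21 * C\<^sup>2" "norm f"] PA by simp
  next
    case False
    \<comment> \<open>The threshold is the smallest coefficient on \<open>A\<close>. If it is 0, all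
      coefficients off \<open>A\<close> vanish and \<open>f\<close> equals its projection.\<close>
    define t where "t = Min ((\<lambda>j. norm (c j f)) ` A)"
    have tA: "norm (c j f) \<ge> t" if "j \<in> A" for j using that A by (simp add: t_def)
    have "t \<in> (\<lambda>j. norm (c j f)) ` A" unfolding t_def using A False by (intro Min_in) auto
    then have tn: "norm (c j f) \<le> t" if "j \<notin> A" for j using gr that by (auto simp: coord_eq)
    have t0: "t \<ge> 0" using \<open>t \<in> _\<close> by auto
    show ?thesis
    proof (cases "t = 0")
      case True
      have "f - ?z A = 0"
        using tn True by (intro eq_zeroI) (auto simp: lin biorth_sum[OF biorth A])
      then show ?thesis by (simp add: PA)
    next
      case tz: False
      then have t: "t > 0" using t0 by simp
      have cardd: "card (B - A) \<le> card (A - B)"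
      proof -
        have "card B = card (A \<inter> B) + card (B - A)" using B by (metis Int_commute card_Int_Diff)
        moreover have "card A = card (A \<inter> B) + card (A - B)" using A by (metis card_Int_Diff)
        ultimately show ?thesis using card by linarith
      qed
      let ?y = "\<Sum>j\<in>A - B. smul (c j g) (z j)"
      have dec: "f - ?z A = g - ?y + ?z (B - A)"
      proof -
        have "?z A = ?z (A \<inter> B) + ?z (A - B)" using A by (rule sum.Int_Diff)
        moreover have "?z B = ?z (A \<inter> B) + ?z (B - A)" using B by (metis Int_commute sum.Int_Diff)
        moreover have "?y = ?z (A - B)" by (intro sum.cong) (auto simp: cg)
        ultimately show ?thesis by (simp add: g_def)
      qed
      have "norm (f - ?z A) \<le> norm g + norm ?y + norm (?z (B - A))"
        unfolding dec using norm_triangle_ineq[of "g - ?y" "?z (B - A)"] norm_triangle_ineq4[of g ?y]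
        by linarith
      moreover have "norm ?y \<le> 11 * C\<^sup>2 * norm g"
        using A t tA tn t0 by (intro greedy_projection_bound[OF _ t]) (auto simp: cg)
      moreover have "norm (?z (B - A)) \<le> 9 * C\<^sup>2 * norm g"
      proof -
        have "norm (?z (B - A)) \<le> 3 * C * t * sqrt (real (card (B - A)))"
          using B tn t0 by (intro bounded_coeffs) auto
        also have "\<dots> \<le> 3 * C * (t * sqrt (real (card (A - B))))"
          using cardd C1 t by simp
        also have "\<dots> \<le> 3 * C * (3 * C * norm g)"
          using A t tA C1 by (intro mult_left_mono large_coeffs) (auto simp: cg)
        finally show ?thesis by (simp add: power2_eq_square)
      qed
      moreover have "norm g \<le> C\<^sup>2 * norm g" using one mult_right_mono[of 1 "C\<^sup>2" "norm g"] by simp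
      ultimately have "norm (f - ?z A) \<le> 21 * C\<^sup>2 * norm g" by linarith
      then show ?thesis by (simp add: PA PB g_def)
    qed
  qed
qed

text \<open>From above, \<open>bounded_coeffs\<close> with all coefficients 1; from below,
  \<open>large_coeffs\<close> with threshold 1 for the sum of the first \<open>m\<close>
  vectors.\<close>

theorem fundamental: "approx_on {1..} (fundamental_fun z) (\<lambda>m. ennreal (real m powr (1/2)))"
  unfolding approx_on_def lesssim_on_def
proof (intro conjI exI[of _ "3 * C"] ballI)
  fix m :: nat assume m: "m \<in> {1..}"
  show "fundamental_fun z m \<le> ennreal (3 * C) * ennreal (real m powr (1/2))"
    unfolding fundamental_fun_def
  proof (rule SUP_least)
    fix A :: "nat set" assume A: "A \<in> {A. finite A \<and> card A \<le> m}"
    have "norm (\<Sum>j\<in>A. z j) \<le> 3 * C * 1 * sqrt (real (card A))"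
      using bounded_coeffs[of A "\<lambda>_. 1" 1] A by simp
    also have "\<dots> \<le> 3 * C * sqrt (real m)" using A C1 by simp
    finally show "ennreal (norm (\<Sum>j\<in>A. z j)) \<le> ennreal (3 * C) * ennreal (real m powr (1/2))"
      using C1 by (simp add: powr_half_sqrt ennreal_leI flip: ennreal_mult)
  qed
  have "1 * sqrt (real (card {..<m})) \<le> 3 * C * norm (\<Sum>j<m. z j)"
    using biorth_sum[OF biorth, of "{..<m}" _ "\<lambda>_. 1"] by (intro large_coeffs) auto
  then have "ennreal (real m powr (1/2)) \<le> ennreal (3 * C) * ennreal (norm (\<Sum>j<m. z j))"
    using C1 by (simp add: powr_half_sqrt ennreal_leI flip: ennreal_mult)
  also have "\<dots> \<le> ennreal (3 * C) * fundamental_fun z m"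
    unfolding fundamental_fun_def by (intro mult_left_mono SUP_upper) auto
  finally show "ennreal (real m powr (1/2)) \<le> ennreal (3 * C) * fundamental_fun z m" .
qed

theorem conditionality_upper: "lesssim_on {2..} (w_conditionality smul z) (\<lambda>m. ennreal (ln (real m)))"
  unfolding lesssim_on_def
proof (intro exI[of _ "8 * C\<^sup>2"] ballI)
  fix m :: nat assume "m \<in> {2..}"
  then have m: "m \<ge> 2" by simp
  show "w_conditionality smul z m \<le> ennreal (8 * C\<^sup>2) * ennreal (ln (real m))"
    unfolding w_conditionality_def
  proof (rule SUP_least, clarsimp)
    fix f A assume f: "f \<noteq> 0" and s: "basis_supp smul z f \<subseteq> {..<m}"
    \<comment> \<open>For \<open>m \<ge> 2\<close> the additive constant 1 + 1 is absorbed by 3 ln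
      m.\<close>
    have "ln 2 \<le> ln (real m)" using m by simp
    then have l: "2 \<le> 3 * ln (real m)" using ln2_ge_two_thirds by linarith
    have "c j f = 0" if "j \<ge> m" for j using s that by (auto simp: basis_supp_def coord_eq)
    then have "coord_proj smul z A f = (\<Sum>j\<in>A \<inter> {..<m}. smul (c j f) (z j))"
      by (intro coord_proj_finite) auto
    then have "norm (coord_proj smul z A f) \<le> 2 * C\<^sup>2 * (1 + (\<Sum>j\<in>A \<inter> {..<m}. 1 / (real j + 1))) * norm f"
      by (simp add: projection_bound)
    also have "\<dots> \<le> 2 * C\<^sup>2 * (4 * ln (real m)) * norm f"
    proof (intro mult_right_mono mult_left_mono)
      have "(\<Sum>j\<in>A \<inter> {..<m}. 1 / (real j + 1)) \<le> (\<Sum>j<m. 1 / (real j + 1))"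
        by (intro sum_mono2) auto
      also have "\<dots> \<le> 1 + ln (real m)" using m by (intro sum_inverse_le_ln) auto
      finally show "1 + (\<Sum>j\<in>A \<inter> {..<m}. 1 / (real j + 1)) \<le> 4 * ln (real m)" using l by linarith
    qed auto
    finally have "norm (coord_proj smul z A f) / norm f \<le> 8 * C\<^sup>2 * ln (real m)"
      using f by (simp add: pos_divide_le_eq)
    then show "ennreal (norm (coord_proj smul z A f) / norm f) \<le> ennreal (8 * C\<^sup>2) * ennreal (ln (real m))"
      using m by (simp add: ennreal_leI flip: ennreal_mult)
  qed
qed

end

section \<open>A highly conditional basis from a basis of type P\<close>

text \<open>For strictly increasing \<open>a\<close> with \<open>a 0 = 0\<close>, the number of the
  interval from \<open>a s\<close> to \<open>a (Suc s) - 1\<close> that contains \<open>i\<close>;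
  the maximum exists because then \<open>s \<le> a s\<close>.\<close>

definition block :: "(nat \<Rightarrow> nat) \<Rightarrow> nat \<Rightarrow> nat" where
  "block a i = (GREATEST s. a s \<le> i)"

lemma block_bounds:
  assumes "strict_mono a" "a 0 = (0::nat)"
  shows "a (block a i) \<le> i" "i < a (Suc (block a i))"
proof -
  have bd: "s \<le> i" if "a s \<le> i" for s
    using strict_mono_imp_increasing[OF assms(1), of s] that by linarith
  show "a (block a i) \<le> i" unfolding block_def
    by (rule GreatestI_nat[where k = 0 and b = i]) (use assms bd in auto)
  have "s \<le> block a i" if "a s \<le> i" for s unfolding block_def
    by (rule Greatest_le_nat[where b = i]) (use that bd in auto)
  from this[of "Suc (block a i)"] show "i < a (Suc (block a i))" by force
qed

lemma block_unique:
  assumes "strict_mono a" "a 0 = 0" "a s \<le> i" "i < a (Suc s)"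
  shows "block a i = s"
proof -
  have "a s < a (Suc (block a i))" "a (block a i) < a (Suc s)"
    using block_bounds[OF assms(1,2), of i] assms(3,4) by linarith+
  then show ?thesis using assms(1) by (simp add: strict_mono_less)
qed

text \<open>The total length of the blocks before block \<open>s\<close>, block k having length 2 *
  2^k.\<close>

definition start :: "nat \<Rightarrow> nat" where
  "start s = 2 * (2 ^ s - 1)"

lemma start_0: "start 0 = 0" and start_Suc: "start (Suc s) = start s + 2 * 2 ^ s"
proof -
  have "(1::nat) \<le> 2 ^ s" by simp
  then show "start (Suc s) = start s + 2 * 2 ^ s" unfolding start_def by (simp add: diff_mult_distrib2)
qed (simp add: start_def)

lemma strict_mono_start: "strict_mono start"
  by (rule strict_monoI_Suc) (simp add: start_Suc)

lemma block_start:
  assumes "i < 2 * 2 ^ s"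
  shows "block start (start s + i) = s"
  using assms by (intro block_unique strict_mono_start start_0) (auto simp: start_Suc)

lemma start_cases:
  obtains s j where "i = start s + 2 * j" "j < 2 ^ s" | s j where "i = Suc (start s + 2 * j)" "j < 2 ^ s"
proof -
  define s where "s = block start i"
  define d where "d = i - start s"
  have s: "start s \<le> i" "i < start s + 2 * 2 ^ s"
    using block_bounds[OF strict_mono_start start_0, of i] by (simp_all add: s_def start_Suc)
  have i: "i = start s + d" "d < 2 * 2 ^ s" using s by (auto simp: d_def)
  show ?thesis
  proof (cases "even d")
    case True
    then obtain j where "d = 2 * j" by blast
    then show ?thesis using i that(1)[of s j] by simp
  next
    case False
    then obtain j where "d = 2 * j + 1" by (rule oddE)
    then show ?thesis using i that(2)[of s j] by simp
  qed
qed

lemma start_disjoint: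
  "s = s' \<or> start s + 2 * 2 ^ s \<le> start s' \<or> start s' + 2 * 2 ^ s' \<le> start s"
proof -
  have "start (Suc u) \<le> start v" if "u < v" for u v
    using that strict_mono_start by (simp add: strict_mono_less_eq)
  then show ?thesis by (metis linorder_neqE_nat start_Suc)
qed

context scalar_banach
begin

text \<open>In a block \<open>[p, p + 2 N)\<close> the two halves of the original basis are interlaced: \<open>zig\<close> is the
  sequence of differences \<open>y\<^sub>1, y\<^sub>2 - y\<^sub>1, y\<^sub>3 - y\<^sub>2, \<dots>\<close>, where \<open>y\<close> alternates between partial sums
  of the first half and partial sums of the second half. The partial sums of \<open>zig\<close> are the bounded
  vectors \<open>y\<close>, while the vectors at even positions all have coordinate 1 at \<open>p\<close>.\<close>

definition zig :: "(nat \<Rightarrow> 'a) \<Rightarrow> nat \<Rightarrow> 'a" where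
  "zig x i = (let s = block start i; p = start s; N = 2 ^ s; j = (i - p) div 2 in
     if even (i - p) then (\<Sum>l<Suc j. x (p + l)) - (\<Sum>l<j. x (p + N + l))
     else (\<Sum>l<Suc j. x (p + N + l)) - (\<Sum>l<Suc j. x (p + l)))"

text \<open>Each original vector past the first of a block is a sum of two consecutive
  \<open>zig\<close> vectors: \<open>x (p + j)\<close> of those at positions 2 j - 1 and 2 j,
  \<open>x (p + N + j)\<close> of those at 2 j and 2 j + 1. Collecting coefficients gives the
  functionals; at the last odd position there is no further first-half vector, hence the
  cutoff.\<close>

definition zig_coord :: "(nat \<Rightarrow> 'a \<Rightarrow> 'k) \<Rightarrow> nat \<Rightarrow> 'a \<Rightarrow> 'k" where
  "zig_coord \<alpha> i f = (let s = block start i; p = start s; N = 2 ^ s; j = (i - p) div 2 in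
     if even (i - p) then \<alpha> (p + j) f + \<alpha> (p + N + j) f
     else \<alpha> (p + N + j) f + (if Suc j < N then \<alpha> (p + Suc j) f else 0))"

lemma zig_even: "j < 2 ^ s \<Longrightarrow> zig x (start s + 2 * j) =
    (\<Sum>l<Suc j. x (start s + l)) - (\<Sum>l<j. x (start s + 2 ^ s + l))"
  and zig_odd: "j < 2 ^ s \<Longrightarrow> zig x (Suc (start s + 2 * j)) =
    (\<Sum>l<Suc j. x (start s + 2 ^ s + l)) - (\<Sum>l<Suc j. x (start s + l))"
  unfolding zig_def add_Suc_right[symmetric] by (subst block_start; simp add: Let_def)+

lemma zig_coord_even: "j < 2 ^ s \<Longrightarrow> zig_coord \<alpha> (start s + 2 * j) f =
    \<alpha> (start s + j) f + \<alpha> (start s + 2 ^ s + j) f"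
  and zig_coord_odd: "j < 2 ^ s \<Longrightarrow> zig_coord \<alpha> (Suc (start s + 2 * j)) f =
    \<alpha> (start s + 2 ^ s + j) f + (if Suc j < 2 ^ s then \<alpha> (start s + Suc j) f else 0)"
  unfolding zig_coord_def add_Suc_right[symmetric] by (subst block_start; simp add: Let_def)+

end

section \<open>The interlaced system as a basis\<close>

locale bounded_sums_basis = scalar_banach smul
  for smul :: "'k::{real_normed_field,euclidean_space} \<Rightarrow> 'a::banach \<Rightarrow> 'a" +
  fixes x :: "nat \<Rightarrow> 'a" and \<alpha> :: "nat \<Rightarrow> 'a \<Rightarrow> 'k" and K :: real
  assumes K0: "K \<ge> 0"
    and basis: "bounded_basis x \<alpha> K"
    and coord_le: "norm (\<alpha> n f) \<le> K * norm f"
    and sums_le: "norm (\<Sum>j<n. x j) \<le> K"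
begin

lemma biorth: "biorth x \<alpha>" using basis by (simp add: bounded_basis_def)

lemma bfun_coord: "bfun (\<alpha> n)" using biorth by (simp add: biorth_def)

lemma coord_interval: "\<alpha> q (\<Sum>l<n. x (p + l)) = (if p \<le> q \<and> q < p + n then 1 else 0)"
proof -
  have "(\<Sum>l<n. x (p + l)) = (\<Sum>k\<in>{p..<p + n}. smul 1 (x k))"
    using sum.shift_bounds_nat_ivl[of x 0 p n] by (simp add: atLeast0LessThan add.commute)
  then show ?thesis using biorth_sum[OF biorth, of "{p..<p+n}" q "\<lambda>_. 1"] by simp
qed

lemma interval_sum: "(\<Sum>l<n. h (p + l)) = (\<Sum>l<p + n. h l) - (\<Sum>l<p. h l)" for h :: "nat \<Rightarrow> 'a"
  by (induction n) auto

lemma interval_le: "norm (\<Sum>l<n. x (p + l)) \<le> 2 * K"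
  unfolding interval_sum using norm_triangle_ineq4[of "\<Sum>l<p + n. x l" "\<Sum>l<p. x l"] sums_le[of "p + n"] sums_le[of p]
  by linarith

lemma interval_proj_le: "norm (\<Sum>l<n. smul (\<alpha> (p + l) f) (x (p + l))) \<le> 2 * K * norm f"
proof -
  have b: "norm (\<Sum>l<m. smul (\<alpha> l f) (x l)) \<le> K * norm f" for m
    using basis by (auto simp: bounded_basis_def)
  show ?thesis
    unfolding interval_sum[of "\<lambda>l. smul (\<alpha> l f) (x l)"]
    using norm_triangle_ineq4[of "\<Sum>l<p + n. smul (\<alpha> l f) (x l)" "\<Sum>l<p. smul (\<alpha> l f) (x l)"]
      b[of "p + n"] b[of p] by linarith
qed

lemma zig_le: "norm (zig x i) \<le> 4 * K"
proof -
  have 1: "norm (u - v) \<le> 4 * K" if "norm u \<le> 2 * K" "norm v \<le> 2 * K" for u v :: 'a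
    using norm_triangle_ineq4[of u v] that by linarith
  show ?thesis by (rule start_cases[of i]) (simp_all only: zig_even zig_odd, (intro 1 interval_le)+)
qed

lemma zig_coord_le: "norm (zig_coord \<alpha> i f) \<le> 2 * K * norm f"
proof -
  have 1: "norm (u + v) \<le> 2 * K * norm f" if "norm u \<le> K * norm f" "norm v \<le> K * norm f" for u v :: 'k
    using norm_triangle_ineq[of u v] that by linarith
  have 2: "0 \<le> K * norm f" using K0 by simp
  show ?thesis
    by (rule start_cases[of i])
      (simp_all only: zig_coord_even zig_coord_odd, (intro 1; simp add: coord_le 2)+)
qed

lemma bfun_zig_coord: "bfun (zig_coord \<alpha> i)"
proof -
  have 1: "bfun (\<lambda>f. if b then \<alpha> q f else 0)" for b q
    by (cases b) (simp_all add: bfun_coord bfun_zero)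
  have "bfun (\<lambda>f. zig_coord \<alpha> i f)"
    by (rule start_cases[of i])
      (simp_all only: zig_coord_even zig_coord_odd, (intro bfun_add bfun_coord 1)+)
  then show ?thesis .
qed

text \<open>By \<open>coord_interval\<close> every value is a combination of interval memberships,
  checked for each pair of parities; \<open>start_disjoint\<close> makes the contributions of
  different blocks vanish.\<close>

lemma zig_biorth: "biorth (zig x) (zig_coord \<alpha>)"
  unfolding biorth_def
proof (intro conjI allI bfun_zig_coord)
  fix i k
  note c = zig_coord_even zig_coord_odd zig_even zig_odd bfun_lin(2)[OF bfun_coord] coord_interval
  show "zig_coord \<alpha> i (zig x k) = (if i = k then 1 else 0)"
  proof (cases i rule: start_cases; cases k rule: start_cases)
    fix s j s' j'
    assume "i = start s + 2 * j" "j < 2 ^ s" "k = start s' + 2 * j'" "j' < 2 ^ s'"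
    then show ?thesis using start_disjoint[of s s'] by (auto simp: c simp del: sum.lessThan_Suc)
  next
    fix s j s' j'
    assume "i = start s + 2 * j" "j < 2 ^ s" "k = Suc (start s' + 2 * j')" "j' < 2 ^ s'"
    then show ?thesis using start_disjoint[of s s'] by (auto simp: c simp del: sum.lessThan_Suc)
  next
    fix s j s' j'
    assume "i = Suc (start s + 2 * j)" "j < 2 ^ s" "k = start s' + 2 * j'" "j' < 2 ^ s'"
    then show ?thesis using start_disjoint[of s s'] by (auto simp: c simp del: sum.lessThan_Suc)
  next
    fix s j s' j'
    assume "i = Suc (start s + 2 * j)" "j < 2 ^ s" "k = Suc (start s' + 2 * j')" "j' < 2 ^ s'"
    then show ?thesis using start_disjoint[of s s'] by (auto simp: c simp del: sum.lessThan_Suc)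
  qed
qed

text \<open>Summation by parts. The functional at position 2 m - 1 already contains the coordinate
  at \<open>start s + m\<close>, whose vector is completed only by position 2 m. The last term
  corrects for this; its vector factor is a difference of bounded interval sums, and it vanishes at
  the end of the block.\<close>

lemma zig_block_sum:
  assumes "m \<le> 2 ^ s"
  shows "(\<Sum>i<2 * m. smul (zig_coord \<alpha> (start s + i) f) (zig x (start s + i))) =
    (\<Sum>l<m. smul (\<alpha> (start s + l) f) (x (start s + l))) +
    (\<Sum>l<m. smul (\<alpha> (start s + 2 ^ s + l) f) (x (start s + 2 ^ s + l))) -
    smul (if m < 2 ^ s then \<alpha> (start s + m) f else 0)
      ((\<Sum>l<m. x (start s + l)) - (\<Sum>l<m. x (start s + 2 ^ s + l)))"
  using assms
proof (induction m)
  case (Suc m)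
  then have m: "m < 2 ^ s" by simp
  have "(\<Sum>i<2 * Suc m. smul (zig_coord \<alpha> (start s + i) f) (zig x (start s + i))) =
     (\<Sum>i<2 * m. smul (zig_coord \<alpha> (start s + i) f) (zig x (start s + i))) +
     smul (zig_coord \<alpha> (start s + 2 * m) f) (zig x (start s + 2 * m)) +
     smul (zig_coord \<alpha> (Suc (start s + 2 * m)) f) (zig x (Suc (start s + 2 * m)))"
    by simp
  then show ?case using Suc.IH m
    by (simp only: zig_coord_even[OF m] zig_coord_odd[OF m] zig_even[OF m] zig_odd[OF m])
      (simp add: smul.add_left smul.add_right smul.diff_right algebra_simps)
qed simp

lemma zig_block_sum_le:
  assumes "t \<le> 2 * 2 ^ s"
  shows "norm (\<Sum>i<t. smul (zig_coord \<alpha> (start s + i) f) (zig x (start s + i))) \<le> (4 * K + 12 * K\<^sup>2) * norm f"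
proof -
  let ?h = "\<lambda>i. smul (zig_coord \<alpha> (start s + i) f) (zig x (start s + i))"
  define m where "m = t div 2"
  have m: "m \<le> 2 ^ s" using assms by (simp add: m_def)
  define u where "u = (\<Sum>l<m. smul (\<alpha> (start s + l) f) (x (start s + l)))"
  define v where "v = (\<Sum>l<m. smul (\<alpha> (start s + 2 ^ s + l) f) (x (start s + 2 ^ s + l)))"
  define e where "e = (if m < 2 ^ s then \<alpha> (start s + m) f else 0)"
  define w where "w = (\<Sum>l<m. x (start s + l)) - (\<Sum>l<m. x (start s + 2 ^ s + l))"
  have eq: "(\<Sum>i<2 * m. ?h i) = u + v - smul e w"
    unfolding zig_block_sum[OF m] u_def v_def e_def w_def ..
  have u: "norm u \<le> 2 * K * norm f" and v: "norm v \<le> 2 * K * norm f"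
    unfolding u_def v_def by (rule interval_proj_le)+
  have e: "norm e \<le> K * norm f" using coord_le K0 by (simp add: e_def)
  have w: "norm w \<le> 4 * K" unfolding w_def
    using norm_triangle_ineq4[of "\<Sum>l<m. x (start s + l)" "\<Sum>l<m. x (start s + 2 ^ s + l)"]
      interval_le[of "start s" m] interval_le[of "start s + 2 ^ s" m] by linarith
  have "norm e * norm w \<le> (K * norm f) * (4 * K)" using e w K0 by (intro mult_mono) auto
  then have 1: "norm (\<Sum>i<2 * m. ?h i) \<le> (4 * K + 4 * K\<^sup>2) * norm f"
    unfolding eq using norm_triangle_ineq4[of "u + v" "smul e w"] norm_triangle_ineq[of u v] u v
    by (simp add: norm_smul power2_eq_square algebra_simps)
  have "norm (?h i) \<le> (2 * K * norm f) * (4 * K)" for i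
    unfolding norm_smul using zig_coord_le zig_le K0 by (intro mult_mono) auto
  then have 2: "norm (?h i) \<le> 8 * K\<^sup>2 * norm f" for i by (simp add: power2_eq_square mult_ac)
  show ?thesis
  proof (cases "even t")
    case True
    then have "t = 2 * m" by (simp add: m_def)
    then have "norm (\<Sum>i<t. ?h i) \<le> (4 * K + 4 * K\<^sup>2) * norm f" using 1 by simp
    also have "\<dots> \<le> (4 * K + 12 * K\<^sup>2) * norm f" by (intro mult_right_mono) auto
    finally show ?thesis .
  next
    case False
    then have t: "t = Suc (2 * m)" by (simp add: m_def)
    have "norm (\<Sum>i<t. ?h i) \<le> norm (\<Sum>i<2 * m. ?h i) + norm (?h (2 * m))"
      unfolding t sum.lessThan_Suc by (rule norm_triangle_ineq)
    also have "\<dots> \<le> (4 * K + 12 * K\<^sup>2) * norm f" using 1 2[of "2 * m"] by (simp add: algebra_simps)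
    finally show ?thesis .
  qed
qed

text \<open>On a complete block the correction term is absent, so both systems have the same partial
  sums at block ends.\<close>

lemma zig_start_sum:
  "(\<Sum>i<start s. smul (zig_coord \<alpha> i f) (zig x i)) = (\<Sum>i<start s. smul (\<alpha> i f) (x i))"
proof (induction s)
  case (Suc s)
  let ?h = "\<lambda>i. smul (zig_coord \<alpha> i f) (zig x i)"
  let ?k = "\<lambda>i. smul (\<alpha> i f) (x i)"
  have "(\<Sum>i<2 * 2 ^ s. ?h (start s + i)) = (\<Sum>i<2 ^ s. ?k (start s + i)) + (\<Sum>i<2 ^ s. ?k (start s + 2 ^ s + i))"
    by (subst zig_block_sum) simp_all
  then have "(\<Sum>i<start s + 2 * 2 ^ s. ?h i) - (\<Sum>i<start s. ?h i) =
      (\<Sum>i<start s + 2 ^ s + 2 ^ s. ?k i) - (\<Sum>i<start s. ?k i)"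
    unfolding interval_sum[of ?h] interval_sum[of ?k] by simp
  then show ?case using Suc.IH by (simp add: start_Suc mult_2 add.assoc)
qed (simp add: start_0)

text \<open>Up to the last block end the partial sum is one of the original basis, and
  \<open>zig_block_sum_le\<close> controls the incomplete block; block ends also provide the
  approximation.\<close>

lemma zig_basis: "bounded_basis (zig x) (zig_coord \<alpha>) (5 * K + 12 * K\<^sup>2)"
proof (rule bounded_basisI[OF zig_biorth])
  fix n f
  define s where "s = block start n"
  have s: "start s \<le> n" "n < start (Suc s)"
    unfolding s_def by (rule block_bounds[OF strict_mono_start start_0])+
  define t where "t = n - start s"
  have n: "n = start s + t" and t: "t \<le> 2 * 2 ^ s" using s by (auto simp: t_def start_Suc)
  let ?h = "\<lambda>i. smul (zig_coord \<alpha> i f) (zig x i)"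
  have "(\<Sum>i<n. ?h i) = (\<Sum>i<start s. smul (\<alpha> i f) (x i)) + (\<Sum>i<t. ?h (start s + i))"
    unfolding interval_sum[of ?h] n by (simp add: zig_start_sum)
  also have "norm \<dots> \<le> K * norm f + (4 * K + 12 * K\<^sup>2) * norm f"
    using basis by (intro norm_triangle_le add_mono zig_block_sum_le t) (auto simp: bounded_basis_def)
  finally show "norm (\<Sum>i<n. ?h i) \<le> (5 * K + 12 * K\<^sup>2) * norm f" by (simp add: algebra_simps)
next
  fix f and e :: real assume e: "e > 0"
  have "(\<lambda>n. \<Sum>i<n. smul (\<alpha> i f) (x i)) \<longlonglongrightarrow> f" using basis by (auto simp: bounded_basis_def sums_def)
  from LIMSEQ_subseq_LIMSEQ[OF this strict_mono_start]
  have "(\<lambda>s. \<Sum>i<start s. smul (\<alpha> i f) (x i)) \<longlonglongrightarrow> f" by (simp add: o_def)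
  then obtain s where "norm ((\<Sum>i<start s. smul (\<alpha> i f) (x i)) - f) < e"
    using LIMSEQ_D[OF _ e] by blast
  then show "\<exists>n. norm ((\<Sum>i<n. smul (zig_coord \<alpha> i f) (zig x i)) - f) < e"
    by (intro exI[of _ "start s"]) (simp add: zig_start_sum)
qed

lemma zig_sum:
  assumes "m \<le> 2 ^ s"
  shows "(\<Sum>i<2 * m. zig x (start s + i)) = (\<Sum>l<m. x (start s + 2 ^ s + l))"
  using assms
proof (induction m)
  case (Suc m)
  then have m: "m < 2 ^ s" by simp
  have "(\<Sum>i<2 * Suc m. zig x (start s + i)) = (\<Sum>i<2 * m. zig x (start s + i)) +
     zig x (start s + 2 * m) + zig x (Suc (start s + 2 * m))" by simp
  then show ?case using Suc.IH m by (simp only: zig_even[OF m] zig_odd[OF m]) simp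
qed simp

text \<open>\<open>W\<close> is the last complete block inside \<open>{..<n}\<close> and
  \<open>V\<close> its even positions. The sum over \<open>W\<close> telescopes to an interval sum
  of \<open>x\<close>, whereas every vector of \<open>V\<close> contributes 1 to the coordinate at
  \<open>start s\<close>.\<close>

lemma zig_windows:
  assumes "n \<ge> 1"
  shows "\<exists>W V. V \<subseteq> W \<and> W \<subseteq> {..<n} \<and> norm (\<Sum>i\<in>W. zig x i) \<le> 4 * K \<and>
    real n \<le> 8 * K * norm (\<Sum>i\<in>V. zig x i)"
proof (cases "n = 1")
  \<comment> \<open>No complete block fits here, since block 0 already has length 2; a single vector
    serves as both windows.\<close>
  case True
  have "1 = norm (zig_coord \<alpha> 0 (zig x 0))" using zig_biorth by (simp add: biorth_def)
  also have "\<dots> \<le> 2 * K * norm (zig x 0)" by (rule zig_coord_le)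
  also have "\<dots> \<le> 8 * K * norm (zig x 0)" using K0 by (intro mult_right_mono) auto
  finally show ?thesis using True zig_le[of 0] by (intro exI[of _ "{0}"]) auto
next
  case False
  define q where "q = block start n"
  have q: "start q \<le> n" "n < start (Suc q)"
    unfolding q_def by (rule block_bounds[OF strict_mono_start start_0])+
  have "q \<noteq> 0" using q False assms by (intro notI) (simp add: start_Suc start_0)
  then obtain s where s: "q = Suc s" using not0_implies_Suc by blast
  have n1: "start s + 2 * 2 ^ s \<le> n" using q s by (simp add: start_Suc)
  \<comment> \<open>The last complete block holds a fixed proportion of the indices:
    \<open>n\<close> lies below the end of the next block, which is less than 8 * 2^s.\<close>
  have n2: "n \<le> 8 * 2 ^ s" using q(2) by (simp add: s start_def)
  define W where "W = (\<lambda>i. start s + i) ` {..<2 * 2 ^ s}"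
  define V where "V = (\<lambda>j. start s + 2 * j) ` {..<2 ^ s}"
  have 1: "V \<subseteq> W" by (auto simp: V_def W_def)
  have 2: "W \<subseteq> {..<n}" using n1 by (auto simp: W_def)
  have "(\<Sum>i\<in>W. zig x i) = (\<Sum>i<2 * 2 ^ s. zig x (start s + i))"
    unfolding W_def by (subst sum.reindex) (auto simp: inj_on_def)
  also have "norm \<dots> \<le> 4 * K"
    unfolding zig_sum[OF order_refl] using interval_le[of "start s + 2 ^ s" "2 ^ s"] K0 by linarith
  finally have 3: "norm (\<Sum>i\<in>W. zig x i) \<le> 4 * K" .
  have "\<alpha> (start s) (\<Sum>i\<in>V. zig x i) = (\<Sum>j<2 ^ s. \<alpha> (start s) (zig x (start s + 2 * j)))"
    unfolding bfun_lin(4)[OF bfun_coord] V_def by (subst sum.reindex) (auto simp: inj_on_def)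
  also have "\<dots> = (\<Sum>j<(2::nat) ^ s. 1)"
    by (intro sum.cong refl) (simp add: zig_even bfun_lin(2)[OF bfun_coord] coord_interval del: sum.lessThan_Suc)
  finally have "norm (\<alpha> (start s) (\<Sum>i\<in>V. zig x i)) = 2 ^ s" by (simp add: norm_power)
  then have "2 ^ s \<le> K * norm (\<Sum>i\<in>V. zig x i)" using coord_le by metis
  then have "real n \<le> 8 * K * norm (\<Sum>i\<in>V. zig x i)"
    using n2 of_nat_mono[OF n2, where ?'a = real] by simp
  then show ?thesis using 1 2 3 by blast
qed

end

context scalar_banach
begin

theorem type_P_conditional_basis:
  assumes sb: "schauder_basis smul x" and P: "type_P x"
  obtains g c K where "bounded_basis g c K" "K > 0" "\<And>i. norm (g i) \<le> K" "\<And>i f. norm (c i f) \<le> K * norm f"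
    "\<And>n. n \<ge> 1 \<Longrightarrow> \<exists>W V. V \<subseteq> W \<and> W \<subseteq> {..<n} \<and> norm (\<Sum>i\<in>W. g i) \<le> K \<and> real n \<le> K * norm (\<Sum>i\<in>V. g i)"
proof -
  let ?c = "coord smul x"
  obtain K where K: "bounded_basis x ?c K" using schauder_bounded_basis[OF sb] by blast
  then have Kb: "\<And>n f. norm (\<Sum>k<n. smul (?c k f) (x k)) \<le> K * norm f" by (simp add: bounded_basis_def)
  obtain M where M: "\<And>k. norm (\<Sum>j<k. x j) \<le> M" using P by (auto simp: type_P_def bdd_above_def)
  define \<delta> where "\<delta> = (INF j. norm (x j))"
  have \<delta>: "\<delta> > 0" using P by (simp add: type_P_def \<delta>_def)
  have \<delta>x: "\<delta> \<le> norm (x j)" for j unfolding \<delta>_def by (intro cINF_lower bdd_belowI[of _ 0]) auto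
  \<comment> \<open>\<open>B\<close> dominates the basis constant, the partial sums of
    \<open>x\<close> and the norms of the coordinate functionals; for the last, the norms of the
    \<open>x j\<close> must stay above \<open>\<delta>\<close>.\<close>
  define B where "B = 2 * \<bar>K\<bar> / \<delta> + \<bar>K\<bar> + \<bar>M\<bar>"
  have B0: "B \<ge> 0" "K \<le> B" "M \<le> B" "2 * \<bar>K\<bar> / \<delta> \<le> B"
  proof -
    have "2 * \<bar>K\<bar> / \<delta> \<ge> 0" using \<delta> by simp
    then show "B \<ge> 0" "K \<le> B" "M \<le> B" "2 * \<bar>K\<bar> / \<delta> \<le> B" unfolding B_def by linarith+
  qed
  interpret bounded_sums_basis smul x ?c B
  proof
    show "bounded_basis x ?c B"
      using K B0(2) order_trans[OF Kb mult_right_mono[OF B0(2) norm_ge_zero]]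
      unfolding bounded_basis_def by blast
    show "norm (?c n f) \<le> B * norm f" for n f
    proof (rule order_trans[OF coord_bounded[OF sb Kb]], rule mult_right_mono)
      have "2 * K / norm (x n) \<le> 2 * \<bar>K\<bar> / \<delta>" using \<delta> \<delta>x[of n] by (intro frac_le) auto
      then show "2 * K / norm (x n) \<le> B" using B0(4) by linarith
    qed simp
    show "norm (\<Sum>j<n. x j) \<le> B" for n using M[of n] B0 by linarith
  qed (rule B0)
  define L where "L = 8 * B + 12 * B\<^sup>2 + 1"
  have L: "L > 0" "5 * B + 12 * B\<^sup>2 \<le> L" "4 * B \<le> L" "2 * B \<le> L" "8 * B \<le> L"
    using B0(1) by (simp_all add: L_def add_nonneg_pos)
  have up: "u \<le> L * norm (f :: 'a)" if "u \<le> r * norm f" "r \<le> L" for u r f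
    using that mult_right_mono[OF that(2), of "norm f"] by simp
  have bb: "bounded_basis (zig x) (zig_coord ?c) L"
    using zig_basis up[OF _ L(2)] unfolding bounded_basis_def by blast
  have gL: "norm (zig x i) \<le> L" for i using zig_le[of i] L by linarith
  have cL: "norm (zig_coord ?c i f) \<le> L * norm f" for i f by (rule up[OF zig_coord_le L(4)])
  have wL: "\<exists>W V. V \<subseteq> W \<and> W \<subseteq> {..<n} \<and> norm (\<Sum>i\<in>W. zig x i) \<le> L \<and> real n \<le> L * norm (\<Sum>i\<in>V. zig x i)"
    if "n \<ge> 1" for n
    using zig_windows[OF that] up[OF _ L(5)] L(3) by (meson order_trans)
  show ?thesis using that[OF bb L(1) gL cL wL] by blast
qed

end

section \<open>Complemented copies of \<open>\<ell>\<^sub>2\<close>\<close>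

text \<open>A copy of the unit vector basis of l2 with functionals defined on the whole space. The
  Bessel inequality there reflects complementation, the upper estimate reflects the
  embedding.\<close>

locale hilbert_system = scalar_banach smul
  for smul :: "'k::{real_normed_field,euclidean_space} \<Rightarrow> 'a::banach \<Rightarrow> 'a" +
  fixes e :: "nat \<Rightarrow> 'a" and e' :: "nat \<Rightarrow> 'a \<Rightarrow> 'k" and K :: real
  assumes K1: "K \<ge> 1"
    and biorth_e: "biorth e e'"
    and bessel_e: "finite F \<Longrightarrow> L2_set (\<lambda>k. norm (e' k f)) F \<le> K * norm f"
    and upper_e: "finite F \<Longrightarrow> norm (\<Sum>k\<in>F. smul (b k) (e k)) \<le> K * L2_set (\<lambda>k. norm (b k)) F"

context scalar_banach
begin

text \<open>The vectors are the images under \<open>T\<close> of the unit vectors; the functionals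
  are the coordinates of \<open>R f\<close>, the preimage under \<open>T\<close> of the projection
  \<open>P f\<close>.\<close>

theorem l2_complemented_hilbert_system:
  assumes "complemented_subspace smul Y" "l2_isomorphic_to smul Y"
  obtains e e' K where "hilbert_system smul e e' K"
proof -
  obtain P where P0: "bounded_linear P" "\<forall>c f. P (smul c f) = smul c (P f)" "P \<circ> P = P" "range P = Y"
    using assms(1) unfolding complemented_subspace_def by (elim exE conjE) (rule that)
  have P: "bounded_linear P" "\<And>c f. P (smul c f) = smul c (P f)" "\<And>f. P (P f) = P f" "range P = Y"
    using P0 by (auto simp: fun_eq_iff)
  obtain T where T0: "\<forall>a\<in>l2_seqs. \<forall>b\<in>l2_seqs. T (\<lambda>n. a n + b n) = T a + T b"
      "\<forall>c. \<forall>a\<in>l2_seqs. T (\<lambda>n. c * a n) = smul c (T a)"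
      "bij_betw T l2_seqs Y"
      "\<exists>C. \<forall>a\<in>l2_seqs. norm (T a) \<le> C * l2_norm a"
      "\<exists>C. \<forall>a\<in>l2_seqs. l2_norm a \<le> C * norm (T a)"
    using assms(2) unfolding l2_isomorphic_to_def by (elim exE conjE) (rule that; (assumption | rule exI, assumption))
  have T: "\<And>a b. a \<in> l2_seqs \<Longrightarrow> b \<in> l2_seqs \<Longrightarrow> T (\<lambda>n. a n + b n) = T a + T b"
      "\<And>c a. a \<in> l2_seqs \<Longrightarrow> T (\<lambda>n. c * a n) = smul c (T a)"
      "bij_betw T l2_seqs Y"
    using T0 by auto
  obtain C1 where C1: "\<And>a. a \<in> l2_seqs \<Longrightarrow> norm (T a) \<le> C1 * l2_norm a" using T0(4) by auto
  obtain C2 where C2: "\<And>a. a \<in> l2_seqs \<Longrightarrow> l2_norm a \<le> C2 * norm (T a)" using T0(5) by auto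
  obtain CP where CP: "CP \<ge> 0" "\<And>f. norm (P f) \<le> CP * norm f"
    using bounded_linear.nonneg_bounded[OF P(1)] by (metis mult.commute)
  have l2_add: "(\<lambda>n. a n + b n) \<in> l2_seqs" if "a \<in> l2_seqs" "b \<in> l2_seqs" for a b :: "nat \<Rightarrow> 'k"
  proof -
    have "summable (\<lambda>n. 2 * (norm (a n))\<^sup>2 + 2 * (norm (b n))\<^sup>2)"
      using that by (intro summable_add summable_mult) (auto simp: l2_seqs_def)
    moreover have "norm ((norm (a n + b n))\<^sup>2) \<le> 2 * (norm (a n))\<^sup>2 + 2 * (norm (b n))\<^sup>2" for n
    proof -
      have "(norm (a n + b n))\<^sup>2 \<le> (norm (a n) + norm (b n))\<^sup>2"
        by (intro power_mono norm_triangle_ineq) auto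
      also have "\<dots> \<le> 2 * (norm (a n))\<^sup>2 + 2 * (norm (b n))\<^sup>2"
        using sum_squares_bound[of "norm (a n)" "norm (b n)"] by (simp add: power2_sum)
      finally show ?thesis by simp
    qed
    ultimately show ?thesis unfolding l2_seqs_def by (auto intro: summable_comparison_test')
  qed
  have l2_mult: "(\<lambda>n. c * a n) \<in> l2_seqs" if "a \<in> l2_seqs" for a and c :: 'k
    using that by (auto simp: l2_seqs_def norm_mult power_mult_distrib intro: summable_mult)
  have l2_fin: "(\<lambda>n. if n \<in> F then b n else 0) \<in> l2_seqs" if "finite F" for F and b :: "nat \<Rightarrow> 'k"
    unfolding l2_seqs_def using that by (auto intro!: summable_finite[of F])
  have l2n_fin: "l2_norm (\<lambda>n. if n \<in> F then b n else 0) = L2_set (\<lambda>n. norm (b n)) F"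
    if "finite F" for F and b :: "nat \<Rightarrow> 'k"
  proof -
    have "(\<Sum>n. (norm (if n \<in> F then b n else 0))\<^sup>2) = (\<Sum>n\<in>F. (norm (if n \<in> F then b n else 0))\<^sup>2)"
      using that by (intro suminf_finite) auto
    then show ?thesis by (simp add: l2_norm_def L2_set_def)
  qed
  define R where "R = (\<lambda>f. inv_into l2_seqs T (P f))"
  have surj: "T ` l2_seqs = Y" and inj: "inj_on T l2_seqs" using T(3) by (auto simp: bij_betw_def)
  have PY: "P f \<in> T ` l2_seqs" for f using P(4) surj by auto
  have R: "R f \<in> l2_seqs" "T (R f) = P f" for f
    unfolding R_def using PY[of f] by (rule inv_into_into, rule f_inv_into_f)
  have Req: "R f = a" if "a \<in> l2_seqs" "T a = P f" for a f
    using inj_onD[OF inj, of "R f" a] R[of f] that by simp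
  have Radd: "R (f + h) = (\<lambda>n. R f n + R h n)" for f h
    using P(1) by (intro Req) (simp_all add: R l2_add T linear_simps)
  have Rsmul: "R (smul c f) = (\<lambda>n. c * R f n)" for c f
    by (intro Req) (simp_all add: R l2_mult T P)
  define \<delta> where "\<delta> = (\<lambda>k n::nat. if n \<in> {k} then 1 else (0::'k))"
  have \<delta>: "\<delta> k \<in> l2_seqs" for k unfolding \<delta>_def by (rule l2_fin) simp
  define e where "e = (\<lambda>k. T (\<delta> k))"
  define e' where "e' = (\<lambda>k f. R f k)"
  have Tfin: "T (\<lambda>n. if n \<in> F then b n else 0) = (\<Sum>k\<in>F. smul (b k) (e k))" if "finite F" for F b
    using that
  proof (induction F)
    case empty
    have "T (\<lambda>n. 0 * \<delta> 0 n) = smul 0 (T (\<delta> 0))" by (rule T(2)[OF \<delta>])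
    then show ?case by simp
  next
    case (insert k F)
    have "(\<lambda>n. if n \<in> insert k F then b n else 0) = (\<lambda>n. b k * \<delta> k n + (if n \<in> F then b n else 0))"
      using insert by (auto simp: \<delta>_def)
    then show ?case using insert by (simp add: T l2_mult l2_fin \<delta> e_def)
  qed
  define K where "K = \<bar>C1\<bar> + \<bar>C2\<bar> * CP + 1"
  have "hilbert_system smul e e' K"
  proof
    show "K \<ge> 1" using CP by (simp add: K_def)
    show bess: "L2_set (\<lambda>k. norm (e' k f)) F \<le> K * norm f" if "finite F" for F f
    proof -
      have "L2_set (\<lambda>k. norm (e' k f)) F \<le> l2_norm (R f)"
        unfolding L2_set_def l2_norm_def e'_def using R(1)[of f] that
        by (intro real_sqrt_le_mono sum_le_suminf) (auto simp: l2_seqs_def)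
      also have "\<dots> \<le> C2 * norm (P f)" using C2[OF R(1)] by (simp add: R)
      also have "\<dots> \<le> \<bar>C2\<bar> * (CP * norm f)" using CP by (intro mult_mono) auto
      also have "\<dots> \<le> K * norm f" by (simp add: K_def algebra_simps)
      finally show ?thesis .
    qed
    show "biorth e e'" unfolding biorth_def
    proof (intro conjI allI)
      show "bfun (e' k)" for k
      proof (rule bfunI[where K = K])
        show "norm (e' k f) \<le> K * norm f" for f using bess[of "{k}" f] by simp
      qed (simp_all add: e'_def Radd Rsmul)
      fix i k
      have "e k \<in> Y" unfolding e_def using \<delta> surj by auto
      then obtain h where "e k = P h" using P(4) by blast
      then have "P (e k) = e k" using P(3) by simp
      then have "R (e k) = \<delta> k" by (intro Req \<delta>) (simp add: e_def)
      then show "e' i (e k) = (if i = k then 1 else 0)" by (simp add: e'_def \<delta>_def)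
    qed
    show "norm (\<Sum>k\<in>F. smul (b k) (e k)) \<le> K * L2_set (\<lambda>k. norm (b k)) F" if "finite F" for F b
    proof -
      have "norm (\<Sum>k\<in>F. smul (b k) (e k)) \<le> C1 * L2_set (\<lambda>k. norm (b k)) F"
        using C1[OF l2_fin[OF that, of b]] by (simp add: Tfin l2n_fin that)
      also have "\<dots> \<le> K * L2_set (\<lambda>k. norm (b k)) F"
        using CP by (intro mult_right_mono) (auto simp: K_def add_increasing2)
      finally show ?thesis .
    qed
  qed
  then show ?thesis by (rule that)
qed

end

section \<open>Operators on the copy of l2 and the absorption of an l2 summand\<close>

context hilbert_system
begin

lemma bfun_e: "bfun (e' k)" and e'_e: "e' i (e k) = (if i = k then 1 else 0)"
  using biorth_e by (auto simp: biorth_def)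

text \<open>For injective \<open>g\<close> and \<open>h\<close> the series converges by
  \<open>move_sums\<close>. The operator sends \<open>e (g k)\<close> to \<open>e (h k)\<close> and
  kills the other \<open>e j\<close> as well as the common kernel of the functionals;
  \<open>move id id\<close> is the projection onto the closed span of the
  \<open>e k\<close>.\<close>

definition move :: "(nat \<Rightarrow> nat) \<Rightarrow> (nat \<Rightarrow> nat) \<Rightarrow> 'a \<Rightarrow> 'a" where
  "move g h f = (\<Sum>k. smul (e' (g k) f) (e (h k)))"

lemma upper_e_reindex:
  assumes "inj h" "finite F"
  shows "norm (\<Sum>k\<in>F. smul (b k) (e (h k))) \<le> K * L2_set (\<lambda>k. norm (b k)) F"
proof -
  have ih: "inj_on h F" using assms(1) inj_on_subset by blast
  have "(\<Sum>k\<in>F. smul (b k) (e (h k))) = (\<Sum>l\<in>h ` F. smul (b (inv h l)) (e l))"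
    using assms(1) by (subst sum.reindex[OF ih]) simp
  also have "norm \<dots> \<le> K * L2_set (\<lambda>l. norm (b (inv h l))) (h ` F)"
    using assms by (intro upper_e) auto
  also have "L2_set (\<lambda>l. norm (b (inv h l))) (h ` F) = L2_set (\<lambda>k. norm (b k)) F"
    using assms(1) unfolding L2_set_def by (subst sum.reindex[OF ih]) simp
  finally show ?thesis .
qed

lemma bessel_e_reindex:
  assumes "inj g" "finite F"
  shows "L2_set (\<lambda>k. norm (e' (g k) f)) F \<le> K * norm f"
proof -
  have "L2_set (\<lambda>k. norm (e' (g k) f)) F = L2_set (\<lambda>k. norm (e' k f)) (g ` F)"
    unfolding L2_set_def using assms(1) by (subst sum.reindex) (auto intro: inj_on_subset)
  then show ?thesis using bessel_e[of "g ` F" f] assms(2) by simp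
qed

text \<open>The Bessel inequality makes the coefficients square summable, and the upper estimate
  turns this into the Cauchy criterion.\<close>

lemma move_sums:
  assumes "inj g" "inj h"
  shows "(\<lambda>k. smul (e' (g k) f) (e (h k))) sums move g h f"
proof -
  let ?b = "\<lambda>k. e' (g k) f"
  have K0: "K > 0" using K1 by simp
  have "(\<Sum>k\<in>F. (norm (?b k))\<^sup>2) \<le> (K * norm f)\<^sup>2" if "finite F" for F
  proof -
    have "(\<Sum>k\<in>F. (norm (?b k))\<^sup>2) = (L2_set (\<lambda>k. norm (?b k)) F)\<^sup>2" by (simp add: L2_set_def sum_nonneg)
    then show ?thesis using bessel_e_reindex[OF assms(1) that, of f] by (simp add: power_mono)
  qed
  then have "summable (\<lambda>k. (norm (?b k))\<^sup>2)"
    by (intro bounded_imp_summable[where B = "(K * norm f)\<^sup>2"]) auto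
  then have C: "\<exists>N. \<forall>m\<ge>N. \<forall>n. norm (\<Sum>k=m..<n. (norm (?b k))\<^sup>2) < d" if "d > 0" for d
    using that unfolding summable_Cauchy by blast
  have "summable (\<lambda>k. smul (?b k) (e (h k)))"
    unfolding summable_Cauchy
  proof (intro allI impI)
    fix d :: real assume d: "d > 0"
    obtain N where N: "\<And>m n. m \<ge> N \<Longrightarrow> norm (\<Sum>k=m..<n. (norm (?b k))\<^sup>2) < (d / K)\<^sup>2"
      using C[of "(d / K)\<^sup>2"] d K0 by auto
    have "norm (\<Sum>k=m..<n. smul (?b k) (e (h k))) < d" if "m \<ge> N" for m n
    proof -
      have "(\<Sum>k=m..<n. (norm (?b k))\<^sup>2) < (d / K)\<^sup>2" using N[OF that, of n] by (simp add: sum_nonneg)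
      then have "L2_set (\<lambda>k. norm (?b k)) {m..<n} < d / K"
        unfolding L2_set_def using d K0 by (intro real_less_lsqrt) auto
      then have "K * L2_set (\<lambda>k. norm (?b k)) {m..<n} < d" using K0 by (simp add: field_simps)
      then show ?thesis using upper_e_reindex[OF assms(2), of "{m..<n}" ?b] by simp
    qed
    then show "\<exists>N. \<forall>m\<ge>N. \<forall>n. norm (\<Sum>k=m..<n. smul (?b k) (e (h k))) < d" by blast
  qed
  then show ?thesis unfolding move_def by (rule summable_sums)
qed

lemma bop_move:
  assumes "inj g" "inj h"
  shows "bop (move g h)"
proof (rule bopI[where K = "K * K"])
  fix f1 f2
  have "(\<lambda>k. smul (e' (g k) (f1 + f2)) (e (h k))) sums (move g h f1 + move g h f2)"
    using sums_add[OF move_sums[OF assms, of f1] move_sums[OF assms, of f2]]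
    by (simp add: bfun_lin[OF bfun_e] smul.add_left)
  then show "move g h (f1 + f2) = move g h f1 + move g h f2"
    using move_sums[OF assms, of "f1 + f2"] sums_unique2 by blast
next
  fix c f
  have "(\<lambda>k. smul c (smul (e' (g k) f) (e (h k)))) sums smul c (move g h f)"
    by (intro bounded_linear.sums[OF smul.bounded_linear_right] move_sums assms)
  then show "move g h (smul c f) = smul c (move g h f)"
    using move_sums[OF assms, of "smul c f"] sums_unique2 by (simp add: bfun_smul[OF bfun_e]) blast
next
  fix f
  show "norm (move g h f) \<le> K * K * norm f"
  proof (rule tendsto_upperbound)
    show "(\<lambda>n. norm (\<Sum>k<n. smul (e' (g k) f) (e (h k)))) \<longlonglongrightarrow> norm (move g h f)"
      using move_sums[OF assms, of f] unfolding sums_def by (rule tendsto_norm)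
    have "norm (\<Sum>k<n. smul (e' (g k) f) (e (h k))) \<le> K * (K * norm f)" for n
      using K1 bessel_e_reindex[OF assms(1), of "{..<n}" f]
      by (intro order_trans[OF upper_e_reindex[OF assms(2)]] mult_left_mono) auto
    then show "\<forall>\<^sub>F n in sequentially. norm (\<Sum>k<n. smul (e' (g k) f) (e (h k))) \<le> K * K * norm f"
      by (simp add: mult.assoc)
  qed simp
qed

lemma e'_move:
  assumes "inj g" "inj h"
  shows "(\<lambda>k. e' (g k) f * (if j = h k then 1 else 0)) sums e' j (move g h f)"
  using bounded_linear.sums[OF bfun_bl[OF bfun_e[of j]] move_sums[OF assms, of f]]
  by (simp add: bfun_smul[OF bfun_e] e'_e)

lemma e'_move_same:
  assumes "inj g" "inj h"
  shows "e' (h k) (move g h f) = e' (g k) f"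
proof -
  have "(\<lambda>i. e' (g i) f * (if h k = h i then 1 else 0)) = (\<lambda>i. if i = k then e' (g i) f else 0)"
    using assms(2) by (auto simp: inj_eq)
  then show ?thesis using e'_move[OF assms, of f "h k"] sums_single[of k "\<lambda>i. e' (g i) f"] sums_unique2 by metis
qed

lemma e'_move_other:
  assumes "inj g" "inj h" "j \<notin> range h"
  shows "e' j (move g h f) = 0"
proof -
  have "(\<lambda>i. e' (g i) f * (if j = h i then 1 else 0)) = (\<lambda>i. 0)" using assms(3) by (intro ext) auto
  then show ?thesis using e'_move[OF assms(1,2), of f j] sums_zero sums_unique2 by metis
qed

lemma move_e:
  assumes "j \<notin> range g"
  shows "move g h (e j) = 0"
proof -
  have "(\<lambda>k. smul (e' (g k) (e j)) (e (h k))) = (\<lambda>k. 0)" using assms by (intro ext) (auto simp: e'_e)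
  then show ?thesis by (simp add: move_def)
qed

abbreviation "proj \<equiv> move id id"

lemma proj_e: "proj (e j) = e j"
proof -
  have "(\<lambda>k. smul (e' (id k) (e j)) (e (id k))) = (\<lambda>k. if k = j then e k else 0)" by (auto simp: e'_e)
  then show ?thesis using sums_single[of j e] by (simp add: move_def sums_iff)
qed

lemma proj_move:
  assumes "inj g" "inj h"
  shows "proj (move g h f) = move g h f"
proof -
  have b: "bop proj" by (simp add: bop_move)
  have "(\<lambda>k. smul (e' (g k) f) (e (h k))) sums proj (move g h f)"
    using bounded_linear.sums[OF bop_bl[OF b] move_sums[OF assms, of f]]
    by (simp add: bop_smul[OF b] proj_e)
  then show ?thesis using move_sums[OF assms, of f] sums_unique2 by blast
qed

text \<open>\<open>pack a\<close> is an isomorphism of the space onto the complement of the closed span of the \<open>e j\<close>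
  with \<open>j \<notin> range a\<close>; it comes from \<open>\<ell>\<^sub>2 \<cong> \<ell>\<^sub>2(range a)\<close>. A left inverse is \<open>unpack a\<close>.\<close>

definition pack :: "(nat \<Rightarrow> nat) \<Rightarrow> 'a \<Rightarrow> 'a" where
  "pack a f = f - proj f + move id a f"

definition unpack :: "(nat \<Rightarrow> nat) \<Rightarrow> 'a \<Rightarrow> 'a" where
  "unpack a f = f - proj f + move a id f"

lemma bop_comb:
  assumes "bop L" "bop L'"
  shows "bop (\<lambda>f. f - L f + L' f)"
  using assms unfolding bop_def
  by (auto intro!: bounded_linear_add bounded_linear_sub bounded_linear_ident
      simp: scale_right_distrib scale_right_diff_distrib)

lemma bop_pack: "inj a \<Longrightarrow> bop (pack a)" and bop_unpack: "inj a \<Longrightarrow> bop (unpack a)"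
  unfolding pack_def[abs_def] unpack_def[abs_def] by (auto intro!: bop_comb bop_move)

lemma e'_pack: "inj a \<Longrightarrow> e' (a k) (pack a f) = e' k f"
  and e'_pack_other: "inj a \<Longrightarrow> j \<notin> range a \<Longrightarrow> e' j (pack a f) = 0"
  and e'_unpack: "inj a \<Longrightarrow> e' k (unpack a f) = e' (a k) f"
  using e'_move_same[of id a k f] e'_move_same[of id id "a k" f] e'_move_other[of id a j f]
    e'_move_same[of id id j f] e'_move_same[of a id k f] e'_move_same[of id id k f]
  by (simp_all add: pack_def unpack_def bfun_lin[OF bfun_e])

lemma proj_pack: "inj a \<Longrightarrow> proj (pack a f) = move id a f"
  and proj_unpack: "inj a \<Longrightarrow> proj (unpack a f) = move a id f"
  using bop_lin[OF bop_move[of id id]] by (simp_all add: pack_def unpack_def proj_move)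

lemma unpack_pack:
  assumes "inj a" shows "unpack a (pack a f) = f"
proof -
  have "move a id (pack a f) = proj f" using assms by (simp add: move_def e'_pack)
  then show ?thesis using assms by (simp add: unpack_def proj_pack) (simp add: pack_def)
qed

text \<open>The right-hand side removes from \<open>f\<close> its components along the
  \<open>e j\<close> with \<open>j \<notin> range a\<close>, so the composition is a projection
  whose kernel is the closed span of these vectors.\<close>

lemma pack_unpack:
  assumes "inj a" shows "pack a (unpack a f) = f - proj f + move a a f"
proof -
  have "move id a (unpack a f) = move a a f" using assms by (simp add: move_def e'_unpack)
  then show ?thesis using assms by (simp add: pack_def proj_unpack) (simp add: unpack_def)
qed

lemma unpack_e: "j \<notin> range a \<Longrightarrow> unpack a (e j) = 0"
  by (simp add: unpack_def proj_e move_e)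

lemma range_strict_mono_lessThan:
  assumes "strict_mono (a :: nat \<Rightarrow> nat)"
  shows "{..<a n} \<inter> range a = a ` {..<n}"
  using assms by (auto simp: strict_mono_less)

text \<open>Cutting at \<open>a n\<close> aligns two series: the indices in \<open>range a\<close>
  below \<open>a n\<close> are exactly a 0, ..., a (n - 1).\<close>

lemma complement_sums:
  assumes a: "strict_mono a"
  shows "(\<lambda>n. \<Sum>j\<in>{..<a n} - range a. smul (e' j f) (e j)) \<longlonglongrightarrow> f - pack a (unpack a f)"
proof -
  have inj: "inj a" using a by (rule strict_mono_imp_inj_on)
  have "(\<lambda>n. \<Sum>j<n. smul (e' j f) (e j)) \<longlonglongrightarrow> proj f"
    using move_sums[of id id f] by (simp add: sums_def)
  from LIMSEQ_subseq_LIMSEQ[OF this a]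
  have 1: "(\<lambda>n. \<Sum>j<a n. smul (e' j f) (e j)) \<longlonglongrightarrow> proj f" by (simp add: o_def)
  have 2: "(\<lambda>n. \<Sum>k<n. smul (e' (a k) f) (e (a k))) \<longlonglongrightarrow> move a a f"
    using move_sums[OF inj inj, of f] by (simp add: sums_def)
  have "(\<Sum>j\<in>{..<a n} - range a. smul (e' j f) (e j)) =
      (\<Sum>j<a n. smul (e' j f) (e j)) - (\<Sum>k<n. smul (e' (a k) f) (e (a k)))" for n
  proof -
    have "(\<Sum>j<a n. smul (e' j f) (e j)) = (\<Sum>j\<in>{..<a n} \<inter> range a. smul (e' j f) (e j)) +
        (\<Sum>j\<in>{..<a n} - range a. smul (e' j f) (e j))"
      by (rule sum.Int_Diff) simp
    also have "(\<Sum>j\<in>{..<a n} \<inter> range a. smul (e' j f) (e j)) = (\<Sum>k<n. smul (e' (a k) f) (e (a k)))"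
      unfolding range_strict_mono_lessThan[OF a]
      by (subst sum.reindex) (use inj in \<open>auto intro: inj_on_subset\<close>)
    finally show ?thesis by simp
  qed
  then show ?thesis using tendsto_diff[OF 1 2] by (simp add: pack_unpack[OF inj])
qed

lemma complement_le: "norm (\<Sum>j\<in>{..<n} - A. smul (e' j f) (e j)) \<le> K * K * norm f"
proof -
  have "norm (\<Sum>j\<in>{..<n} - A. smul (e' j f) (e j)) \<le> K * (K * norm f)"
    using K1 bessel_e[of "{..<n} - A" f] by (intro order_trans[OF upper_e] mult_left_mono) auto
  then show ?thesis by simp
qed

end

section \<open>The rotated basis\<close>

text \<open>With indices from 0, the n-th dyadic block runs from 2^n - 1 to 2^(n+1) - 2 and has
  length 2^n.\<close>

definition dyad :: "nat \<Rightarrow> nat" where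
  "dyad n = 2 ^ n - 1"

lemma dyad_0: "dyad 0 = 0" and dyad_Suc: "dyad (Suc n) = dyad n + 2 ^ n"
proof -
  have "(1::nat) \<le> 2 ^ n" by simp
  then show "dyad (Suc n) = dyad n + 2 ^ n" unfolding dyad_def by simp
qed (simp add: dyad_def)

lemma strict_mono_dyad: "strict_mono dyad"
  by (rule strict_monoI_Suc) (simp add: dyad_Suc)

lemma inj_dyad: "inj dyad" by (rule strict_mono_imp_inj_on[OF strict_mono_dyad])

abbreviation "level \<equiv> block dyad"

lemma level_bounds: "dyad (level j) \<le> j" "j < dyad (Suc (level j))"
  by (rule block_bounds[OF strict_mono_dyad dyad_0])+

lemma level_unique: "dyad n \<le> j \<Longrightarrow> j < dyad (Suc n) \<Longrightarrow> level j = n"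
  by (rule block_unique[OF strict_mono_dyad dyad_0])

lemma level_dyad [simp]: "level (dyad n) = n"
  by (rule level_unique) (simp_all add: dyad_Suc)

lemma less_dyad_iff: "j < dyad n \<longleftrightarrow> level j < n"
  using level_bounds[of j] strict_mono_less_eq[OF strict_mono_dyad, of "Suc (level j)" n]
    strict_mono_less_eq[OF strict_mono_dyad, of n "level j"]
  by (metis Suc_leI leD le_less_trans less_le_trans not_le_imp_less)

text \<open>The Householder reflection that maps the first unit vector of \<open>\<real>\<^sup>N\<close> to the constant unit vector.
  For \<open>N = 1\<close> the denominator vanishes, but the value is not used.\<close>

definition householder :: "nat \<Rightarrow> nat \<Rightarrow> nat \<Rightarrow> real" where
  "householder N i k = (if i = 0 \<or> k = 0 then 1 / sqrt (real N)
     else (if i = k then 1 else 0) - 1 / (real N - sqrt (real N)))"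

lemma householder_commute: "householder N i k = householder N k i"
  by (auto simp: householder_def)

text \<open>With \<open>q\<close> and \<open>\<beta>\<close> as below, the identities 1 - (q^2 - 1)
  \<open>\<beta>\<close> = -1/q and 1/q^2 - 2 \<open>\<beta>\<close> + (q^2 - 1)
  \<open>\<beta>\<close>^2 = 0 settle all products except that of the constant row with
  itself.\<close>

lemma householder_orthogonal:
  assumes "i < N" "k < N"
  shows "(\<Sum>l<N. householder N i l * householder N k l) = (if i = k then 1 else 0)"
proof -
  obtain M where M: "N = Suc M" using assms by (cases N) auto
  define q where "q = sqrt (real N)"
  have q2: "q * q = real N" by (simp add: q_def)
  have q0: "q > 0" using assms by (simp add: q_def)
  have rM: "real M = q * q - 1" using q2 M by simp
  define \<beta> where "\<beta> = 1 / (real N - q)"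
  have split: "(\<Sum>l<N. f l) = f 0 + (\<Sum>l\<in>{1..<N}. f l)" for f :: "nat \<Rightarrow> real"
    using M by (simp add: sum.atLeast_Suc_lessThan flip: atLeast0LessThan)
  have row0: "householder N 0 l = 1 / q" for l by (simp add: householder_def q_def)
  have col0: "householder N l 0 = 1 / q" for l by (simp add: householder_def q_def)
  have row: "householder N i l = (if i = l then 1 else 0) - \<beta>" if "i \<noteq> 0" "l \<in> {1..<N}" for i l
    using that by (simp add: householder_def \<beta>_def q_def)
  show ?thesis
  proof (cases "i = 0")
    case i: True
    show ?thesis
    proof (cases "k = 0")
      case True
      have "(\<Sum>l<N. householder N i l * householder N k l) = real N * (1 / q * (1 / q))"
        unfolding i True row0 by simp
      also have "\<dots> = 1" using q0 unfolding q2[symmetric] by simp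
      finally show ?thesis using i True by simp
    next
      case False
      have N2: "N > 1" using False assms by simp
      have q1: "q > 1" using N2 by (simp add: q_def)
      have "(\<Sum>l\<in>{1..<N}. householder N k l) = (\<Sum>l\<in>{1..<N}. (if k = l then 1 else 0) - \<beta>)"
        by (intro sum.cong refl row False)
      also have "\<dots> = 1 - real M * \<beta>" using False assms M by (simp add: sum_subtractf)
      finally have "(\<Sum>l<N. householder N i l * householder N k l) = 1 / (q * q) + (1 / q) * (1 - real M * \<beta>)"
        unfolding split i row0 col0 sum_distrib_left[symmetric] by (simp add: add_divide_distrib)
      also have "\<dots> = 0" using q1 unfolding rM \<beta>_def q2[symmetric]
        by (simp add: divide_simps) algebra
      finally show ?thesis using i False by simp
    qed
  next
    case i: False
    show ?thesis
    proof (cases "k = 0")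
      case True
      have N2: "N > 1" using i assms by simp
      have q1: "q > 1" using N2 by (simp add: q_def)
      have "(\<Sum>l\<in>{1..<N}. householder N i l) = (\<Sum>l\<in>{1..<N}. (if i = l then 1 else 0) - \<beta>)"
        by (intro sum.cong refl row i)
      also have "\<dots> = 1 - real M * \<beta>" using i assms M by (simp add: sum_subtractf)
      finally have "(\<Sum>l<N. householder N i l * householder N k l) = 1 / (q * q) + (1 / q) * (1 - real M * \<beta>)"
        unfolding split True row0 col0 sum_distrib_right[symmetric] by (simp add: add_divide_distrib)
      also have "\<dots> = 0" using q1 unfolding rM \<beta>_def q2[symmetric]
        by (simp add: divide_simps) algebra
      finally show ?thesis using i True by simp
    next
      case k: False
      have N2: "N > 1" using k assms by simp
      have q1: "q > 1" using N2 by (simp add: q_def)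
      have "(\<Sum>l\<in>{1..<N}. householder N i l * householder N k l) =
          (\<Sum>l\<in>{1..<N}. (if i = l then (if i = k then 1 else 0) else 0)
             - \<beta> * (if i = l then 1 else 0) - \<beta> * (if k = l then 1 else 0) + \<beta> * \<beta>)"
        by (intro sum.cong refl) (auto simp: row i k algebra_simps)
      also have "\<dots> = (if i = k then 1 else 0) - 2 * \<beta> + real M * (\<beta> * \<beta>)"
        using i k assms M by (simp add: sum_subtractf sum.distrib flip: sum_distrib_left)
      finally have "(\<Sum>l<N. householder N i l * householder N k l) =
          1 / (q * q) + ((if i = k then 1 else 0) - 2 * \<beta> + real M * (\<beta> * \<beta>))"
        unfolding split col0 by simp
      moreover have "1 / (q * q) - 2 * \<beta> + real M * (\<beta> * \<beta>) = 0"
        using q1 unfolding rM \<beta>_def q2[symmetric]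
        by (simp add: divide_simps) algebra
      ultimately show ?thesis by simp
    qed
  qed
qed

text \<open>An infinite block-diagonal matrix with the reflection of size 2^n on the n-th dyadic
  block.\<close>

definition hmat :: "nat \<Rightarrow> nat \<Rightarrow> real" where
  "hmat j l = (if level j = level l then
     householder (2 ^ level j) (j - dyad (level j)) (l - dyad (level j)) else 0)"

text \<open>The constant entry in the first column of the block of \<open>j\<close>. It is of order
  (j + 1) ^ (-1/2), which produces the weights in \<open>dkk_estimates\<close>.\<close>

definition weight :: "nat \<Rightarrow> real" where
  "weight j = 1 / sqrt (2 ^ level j)"

lemma hmat_commute: "hmat j l = hmat l j"
  by (simp add: hmat_def householder_commute)

lemma hmat_dyad: "hmat j (dyad n) = (if level j = n then weight j else 0)"
  by (auto simp: hmat_def householder_def weight_def)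

text \<open>Rows live on their own block: different levels have disjoint supports, equal levels
  reduce to \<open>householder_orthogonal\<close>. The range ends at \<open>dyad M\<close> so that
  no block is cut.\<close>

lemma hmat_orthogonal:
  assumes "j < dyad M" "k < dyad M"
  shows "(\<Sum>l<dyad M. hmat j l * hmat k l) = (if j = k then 1 else 0)"
proof (cases "level j = level k")
  case False
  then have "(\<Sum>l<dyad M. hmat j l * hmat k l) = 0" by (intro sum.neutral) (auto simp: hmat_def)
  then show ?thesis using False by auto
next
  case True
  define n where "n = level j"
  have n: "level j = n" "level k = n" using True by (auto simp: n_def)
  define i i' where "i = j - dyad n" and "i' = k - dyad n"
  have i: "j = dyad n + i" "k = dyad n + i'" "i < 2 ^ n" "i' < 2 ^ n"
    using level_bounds[of j] level_bounds[of k] n by (auto simp: i_def i'_def dyad_Suc)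
  have nM: "dyad (Suc n) \<le> dyad M"
    using assms(1) n strict_mono_less_eq[OF strict_mono_dyad] by (simp add: less_dyad_iff Suc_le_eq)
  have "(\<Sum>l<dyad M. hmat j l * hmat k l) = (\<Sum>l\<in>{dyad n..<dyad (Suc n)}. hmat j l * hmat k l)"
  proof (rule sum.mono_neutral_right)
    show "\<forall>l\<in>{..<dyad M} - {dyad n..<dyad (Suc n)}. hmat j l * hmat k l = 0"
    proof
      fix l assume "l \<in> {..<dyad M} - {dyad n..<dyad (Suc n)}"
      then have "level l \<noteq> n" using level_bounds[of l] by auto
      then show "hmat j l * hmat k l = 0" using n by (simp add: hmat_def)
    qed
  qed (use nM in auto)
  also have "\<dots> = (\<Sum>l<2 ^ n. hmat j (dyad n + l) * hmat k (dyad n + l))"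
    using sum.shift_bounds_nat_ivl[of "\<lambda>l. hmat j l * hmat k l" 0 "dyad n" "2 ^ n"]
    by (simp add: dyad_Suc atLeast0LessThan add.commute)
  also have "\<dots> = (\<Sum>l<2 ^ n. householder (2 ^ n) i l * householder (2 ^ n) i' l)"
  proof (rule sum.cong[OF refl])
    fix l :: nat assume "l \<in> {..<2 ^ n}"
    then have "level (dyad n + l) = n" by (intro level_unique) (auto simp: dyad_Suc)
    then show "hmat j (dyad n + l) * hmat k (dyad n + l) = householder (2 ^ n) i l * householder (2 ^ n) i' l"
      using n by (simp add: hmat_def i_def i'_def)
  qed
  also have "\<dots> = (if i = i' then 1 else 0)" by (rule householder_orthogonal) (rule i)+
  finally show ?thesis using i by simp
qed

text \<open>Squared norms expand through the real inner product of \<open>'k\<close>, so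
  orthogonality of the real matrix suffices for complex scalars too.\<close>

lemma hmat_isometry:
  fixes b :: "nat \<Rightarrow> 'k::{real_normed_field,euclidean_space}"
  shows "L2_set (\<lambda>l. norm (\<Sum>j<dyad M. of_real (hmat j l) * b j)) {..<dyad M} =
    L2_set (\<lambda>j. norm (b j)) {..<dyad M}"
proof -
  let ?D = "{..<dyad M}"
  have "(\<Sum>l\<in>?D. (norm (\<Sum>j\<in>?D. of_real (hmat j l) * b j))\<^sup>2) =
      (\<Sum>l\<in>?D. \<Sum>j\<in>?D. \<Sum>k\<in>?D. hmat j l * hmat k l * inner (b k) (b j))"
    unfolding power2_norm_eq_inner
    by (simp add: inner_sum_left inner_sum_right sum_distrib_left mult.assoc flip: scaleR_conv_of_real)
  also have "\<dots> = (\<Sum>j\<in>?D. \<Sum>l\<in>?D. \<Sum>k\<in>?D. hmat j l * hmat k l * inner (b k) (b j))"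
    by (rule sum.swap)
  also have "\<dots> = (\<Sum>j\<in>?D. \<Sum>k\<in>?D. \<Sum>l\<in>?D. hmat j l * hmat k l * inner (b k) (b j))"
    by (rule sum.cong[OF refl], rule sum.swap)
  also have "\<dots> = (\<Sum>j\<in>?D. \<Sum>k\<in>?D. (\<Sum>l\<in>?D. hmat j l * hmat k l) * inner (b k) (b j))"
    by (simp add: sum_distrib_right)
  also have "\<dots> = (\<Sum>j\<in>?D. \<Sum>k\<in>?D. (if j = k then inner (b k) (b j) else 0))"
    by (intro sum.cong refl) (auto simp: hmat_orthogonal)
  also have "\<dots> = (\<Sum>j\<in>?D. (norm (b j))\<^sup>2)" by (simp add: power2_norm_eq_inner)
  finally show ?thesis by (simp add: L2_set_def)
qed

lemma weight_pos: "weight j > 0" by (simp add: weight_def)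

lemma weight_le: "weight j \<le> 2 / sqrt (real j + 1)"
proof -
  have "j + 1 \<le> 2 * 2 ^ level j"
    using level_bounds(2)[of j] by (simp add: dyad_def)
  then have "real (j + 1) \<le> real (2 * 2 ^ level j)" by (simp only: of_nat_le_iff)
  then have "real j + 1 \<le> 2 * 2 ^ level j" by simp
  also have "\<dots> \<le> 4 * 2 ^ level j" by simp
  finally have "sqrt (real j + 1) \<le> sqrt (2\<^sup>2 * 2 ^ level j)" by simp
  also have "\<dots> = 2 * sqrt (2 ^ level j)" by (simp add: real_sqrt_mult)
  finally show ?thesis by (simp add: weight_def divide_simps add_nonneg_pos)
qed

section \<open>Construction of the rotated basis\<close>

locale dkk_construction = hilbert_system smul e e' K
  for smul :: "'k::{real_normed_field,euclidean_space} \<Rightarrow> 'a::banach \<Rightarrow> 'a" and e e' K +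
  fixes g :: "nat \<Rightarrow> 'a" and g' :: "nat \<Rightarrow> 'a \<Rightarrow> 'k"
  assumes g_basis: "bounded_basis g g' K"
    and g_le: "norm (g n) \<le> K"
    and g'_le: "norm (g' n f) \<le> K * norm f"
begin

abbreviation "U \<equiv> pack dyad"
abbreviation "Q \<equiv> unpack dyad"

lemma bop_U: "bop U" and bop_Q: "bop Q"
  by (simp_all add: bop_pack bop_unpack inj_dyad)

lemma biorth_g: "biorth g g'" using g_basis by (simp add: bounded_basis_def)

text \<open>The system before rotation. \<open>U\<close> copies the whole space onto a complement of
  the closed span of the \<open>e l\<close> with \<open>l \<notin> range dyad\<close>, so the
  \<open>U (g n)\<close> and these \<open>e l\<close> fit together. Block \<open>n\<close> starts
  with \<open>U (g n)\<close> and continues with \<open>2 ^ n - 1\<close> vectors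
  \<open>e l\<close>.\<close>

definition w :: "nat \<Rightarrow> 'a" where
  "w l = (if l \<in> range dyad then U (g (level l)) else e l)"

definition w' :: "nat \<Rightarrow> 'a \<Rightarrow> 'k" where
  "w' l f = (if l \<in> range dyad then g' (level l) (Q f) else e' l f)"

definition z :: "nat \<Rightarrow> 'a" where
  "z j = (\<Sum>l<dyad (Suc (level j)). hmat j l *\<^sub>R w l)"

definition z' :: "nat \<Rightarrow> 'a \<Rightarrow> 'k" where
  "z' j f = (\<Sum>l<dyad (Suc (level j)). of_real (hmat j l) * w' l f)"

text \<open>The part of \<open>z'\<close> coming from the copy of l2; the other part is
  \<open>weight j\<close> times a coordinate with respect to \<open>g\<close>.\<close>

definition rest :: "nat \<Rightarrow> 'a \<Rightarrow> 'k" where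
  "rest j f = (\<Sum>l\<in>{..<dyad (Suc (level j))} - range dyad. of_real (hmat j l) * e' l f)"

lemma level_mono_subset: "level j < M \<Longrightarrow> {..<dyad (Suc (level j))} \<subseteq> {..<dyad M}"
  using strict_mono_less_eq[OF strict_mono_dyad, of "Suc (level j)" M] by auto

lemma hmat_nonzero: "hmat j l \<noteq> 0 \<Longrightarrow> l < dyad (Suc (level j))"
  by (auto simp: hmat_def less_dyad_iff split: if_splits)

text \<open>Row \<open>j\<close> of \<open>hmat\<close> vanishes outside its block, so finitely many
  indices can share one range of summation.\<close>

lemma z_eq: "j < dyad M \<Longrightarrow> z j = (\<Sum>l<dyad M. hmat j l *\<^sub>R w l)"
  and z'_eq: "j < dyad M \<Longrightarrow> z' j f = (\<Sum>l<dyad M. of_real (hmat j l) * w' l f)"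
  and rest_eq: "j < dyad M \<Longrightarrow> rest j f = (\<Sum>l\<in>{..<dyad M} - range dyad. of_real (hmat j l) * e' l f)"
  unfolding z_def z'_def rest_def less_dyad_iff
  using level_mono_subset[of j M]
  by (auto intro!: sum.mono_neutral_left intro: hmat_nonzero)

lemma bfun_w': "bfun (w' l)"
proof -
  have "bfun (\<lambda>f. g' n (Q f))" for n
    using biorth_g by (intro bfun_compose[OF _ bop_Q]) (simp add: biorth_def)
  then show ?thesis unfolding w'_def[abs_def] by (cases "l \<in> range dyad") (simp_all add: bfun_e)
qed

lemma w_biorth: "w' i (w k) = (if i = k then 1 else 0)"
proof -
  have gz: "g' n 0 = 0" for n using biorth_g by (simp add: biorth_def bfun_lin)
  have gg: "g' n (g m) = (if n = m then 1 else 0)" for n m using biorth_g by (simp add: biorth_def)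
  show ?thesis
    by (auto simp: w'_def w_def unpack_pack[OF inj_dyad] gg gz unpack_e
        e'_pack_other[OF inj_dyad] e'_e inj_eq[OF inj_dyad])
qed

lemma bfun_z': "bfun (z' j)"
  unfolding z'_def[abs_def] by (intro bfun_sum bfun_cmult bfun_w')

lemma z'_w: "z' j (w k) = of_real (hmat j k)"
proof -
  define M where "M = Suc (level j + level k)"
  have "j < dyad M" "k < dyad M" by (simp_all add: less_dyad_iff M_def)
  then show ?thesis
    by (simp add: z'_eq w_biorth if_distrib[of "\<lambda>x. _ * x"] cong: if_cong)
qed

lemma z_biorth: "biorth z z'"
  unfolding biorth_def
proof (intro conjI allI bfun_z')
  fix i k
  define M where "M = Suc (level i + level k)"
  have M: "i < dyad M" "k < dyad M" by (simp_all add: less_dyad_iff M_def)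
  have "z' i (z k) = (\<Sum>l<dyad M. hmat k l *\<^sub>R z' i (w l))"
    using M by (simp add: z_eq bfun_lin[OF bfun_z'] linear_simps[OF bfun_bl[OF bfun_z']])
  also have "\<dots> = of_real (\<Sum>l<dyad M. hmat i l * hmat k l)"
    by (simp add: z'_w scaleR_conv_of_real mult.commute)
  finally show "z' i (z k) = (if i = k then 1 else 0)" using hmat_orthogonal[OF M] by simp
qed

text \<open>On complete blocks orthogonality cancels the rotation: only the diagonal terms of the
  double sum survive.\<close>

lemma z_block_sum: "(\<Sum>j<dyad M. smul (z' j f) (z j)) = (\<Sum>l<dyad M. smul (w' l f) (w l))"
proof -
  let ?D = "{..<dyad M}"
  have "(\<Sum>j\<in>?D. smul (z' j f) (z j)) =
      (\<Sum>j\<in>?D. \<Sum>l\<in>?D. \<Sum>m\<in>?D. (hmat l j * hmat m j) *\<^sub>R smul (w' l f) (w m))"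
  proof (rule sum.cong[OF refl])
    fix j assume "j \<in> ?D"
    then have "smul (z' j f) (z j) = smul (\<Sum>l\<in>?D. hmat l j *\<^sub>R w' l f) (\<Sum>m\<in>?D. hmat m j *\<^sub>R w m)"
      by (simp add: z_eq z'_eq hmat_commute scaleR_conv_of_real)
    then show "smul (z' j f) (z j) = (\<Sum>l\<in>?D. \<Sum>m\<in>?D. (hmat l j * hmat m j) *\<^sub>R smul (w' l f) (w m))"
      by (simp only: smul.sum_left)
        (simp add: smul.sum_right smul.scaleR_left smul.scaleR_right scaleR_sum_right mult.commute)
  qed
  also have "\<dots> = (\<Sum>l\<in>?D. \<Sum>j\<in>?D. \<Sum>m\<in>?D. (hmat l j * hmat m j) *\<^sub>R smul (w' l f) (w m))"
    by (rule sum.swap)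
  also have "\<dots> = (\<Sum>l\<in>?D. \<Sum>m\<in>?D. \<Sum>j\<in>?D. (hmat l j * hmat m j) *\<^sub>R smul (w' l f) (w m))"
    by (rule sum.cong[OF refl], rule sum.swap)
  also have "\<dots> = (\<Sum>l\<in>?D. \<Sum>m\<in>?D. (\<Sum>j\<in>?D. hmat l j * hmat m j) *\<^sub>R smul (w' l f) (w m))"
    by (simp add: scaleR_sum_left)
  also have "\<dots> = (\<Sum>l\<in>?D. \<Sum>m\<in>?D. (if l = m then smul (w' l f) (w m) else 0))"
    by (intro sum.cong refl) (auto simp: hmat_orthogonal)
  finally show ?thesis by simp
qed

lemma w_sum_split: "(\<Sum>l<dyad M. smul (w' l f) (w l)) =
    U (\<Sum>n<M. smul (g' n (Q f)) (g n)) + (\<Sum>l\<in>{..<dyad M} - range dyad. smul (e' l f) (e l))"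
proof -
  have "(\<Sum>l<dyad M. smul (w' l f) (w l)) = (\<Sum>l\<in>{..<dyad M} \<inter> range dyad. smul (w' l f) (w l)) +
      (\<Sum>l\<in>{..<dyad M} - range dyad. smul (w' l f) (w l))"
    by (rule sum.Int_Diff) simp
  also have "(\<Sum>l\<in>{..<dyad M} \<inter> range dyad. smul (w' l f) (w l)) = (\<Sum>n<M. smul (g' n (Q f)) (U (g n)))"
    unfolding range_strict_mono_lessThan[OF strict_mono_dyad]
    by (subst sum.reindex) (auto simp: w'_def w_def intro: inj_on_subset[OF inj_dyad])
  also have "\<dots> = U (\<Sum>n<M. smul (g' n (Q f)) (g n))"
    by (simp add: bop_lin[OF bop_U] bop_smul[OF bop_U])
  also have "(\<Sum>l\<in>{..<dyad M} - range dyad. smul (w' l f) (w l)) =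
      (\<Sum>l\<in>{..<dyad M} - range dyad. smul (e' l f) (e l))"
    by (intro sum.cong) (auto simp: w'_def w_def)
  finally show ?thesis .
qed

text \<open>At block ends the partial sums are those of the unrotated system, whose two parts
  converge to the complementary components \<open>U (Q f)\<close> and
  \<open>f - U (Q f)\<close>.\<close>

lemma z_block_sum_tendsto: "(\<lambda>M. \<Sum>j<dyad M. smul (z' j f) (z j)) \<longlonglongrightarrow> f"
proof -
  have "(\<lambda>M. \<Sum>n<M. smul (g' n (Q f)) (g n)) \<longlonglongrightarrow> Q f"
    using g_basis by (auto simp: bounded_basis_def sums_def)
  from bounded_linear.tendsto[OF bop_bl[OF bop_U] this]
  have "(\<lambda>M. U (\<Sum>n<M. smul (g' n (Q f)) (g n)) + (\<Sum>l\<in>{..<dyad M} - range dyad. smul (e' l f) (e l)))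
      \<longlonglongrightarrow> U (Q f) + (f - U (Q f))"
    by (intro tendsto_add complement_sums strict_mono_dyad)
  then show ?thesis by (simp add: z_block_sum w_sum_split)
qed

text \<open>Among the indices in \<open>range dyad\<close>, row \<open>j\<close> of
  \<open>hmat\<close> meets only the start of its own block, with entry
  \<open>weight j\<close>.\<close>

lemma z_split:
  assumes "j < dyad M"
  shows "z j = weight j *\<^sub>R U (g (level j)) + (\<Sum>l\<in>{..<dyad M} - range dyad. hmat j l *\<^sub>R e l)"
    and "z' j f = of_real (weight j) * g' (level j) (Q f) + rest j f"
proof -
  have split: "(\<Sum>l<dyad M. h l) = h (dyad (level j)) + (\<Sum>l\<in>{..<dyad M} - range dyad. h l)"
    if "\<And>n. n \<noteq> level j \<Longrightarrow> h (dyad n) = 0" for h :: "nat \<Rightarrow> 'b::comm_monoid_add"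
  proof -
    have "(\<Sum>l<dyad M. h l) = (\<Sum>l\<in>{..<dyad M} \<inter> range dyad. h l) + (\<Sum>l\<in>{..<dyad M} - range dyad. h l)"
      by (rule sum.Int_Diff) simp
    also have "(\<Sum>l\<in>{..<dyad M} \<inter> range dyad. h l) = (\<Sum>l\<in>{dyad (level j)}. h l)"
    proof (rule sum.mono_neutral_right)
      show "\<forall>l\<in>{..<dyad M} \<inter> range dyad - {dyad (level j)}. h l = 0"
        using that by auto metis
    qed (use assms in \<open>auto simp: less_dyad_iff\<close>)
    finally show ?thesis by simp
  qed
  have "(\<Sum>l<dyad M. hmat j l *\<^sub>R w l) = weight j *\<^sub>R U (g (level j)) + (\<Sum>l\<in>{..<dyad M} - range dyad. hmat j l *\<^sub>R w l)"
    by (subst split) (auto simp: hmat_dyad w_def)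
  also have "(\<Sum>l\<in>{..<dyad M} - range dyad. hmat j l *\<^sub>R w l) = (\<Sum>l\<in>{..<dyad M} - range dyad. hmat j l *\<^sub>R e l)"
    by (intro sum.cong) (auto simp: w_def)
  finally show "z j = weight j *\<^sub>R U (g (level j)) + (\<Sum>l\<in>{..<dyad M} - range dyad. hmat j l *\<^sub>R e l)"
    by (simp add: z_eq[OF assms])
  have "(\<Sum>l<dyad M. of_real (hmat j l) * w' l f) =
      of_real (weight j) * g' (level j) (Q f) + (\<Sum>l\<in>{..<dyad M} - range dyad. of_real (hmat j l) * w' l f)"
    by (subst split) (auto simp: hmat_dyad w'_def)
  also have "(\<Sum>l\<in>{..<dyad M} - range dyad. of_real (hmat j l) * w' l f) = rest j f"
    unfolding rest_eq[OF assms] by (intro sum.cong) (auto simp: w'_def)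
  finally show "z' j f = of_real (weight j) * g' (level j) (Q f) + rest j f"
    by (simp add: z'_eq[OF assms])
qed

lemma finite_subset_dyad:
  assumes "finite (F :: nat set)" obtains M where "F \<subseteq> {..<dyad M}"
proof -
  obtain m where "F \<subseteq> {..<m}" using assms by (auto simp: finite_nat_iff_bounded)
  moreover have "m \<le> dyad m" using strict_mono_imp_increasing[OF strict_mono_dyad] .
  ultimately show ?thesis using that[of m] by (meson lessThan_subset_iff order_trans)
qed

text \<open>After enlarging \<open>F\<close> to complete blocks, the remainders are the rotation of
  the sequence \<open>e' l f\<close> with its entries at \<open>range dyad\<close> set to 0, and
  rotation preserves the l2 norm.\<close>

lemma rest_bessel:
  assumes "finite F"
  shows "L2_set (\<lambda>j. norm (rest j f)) F \<le> K * norm f"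
proof -
  obtain M where M: "F \<subseteq> {..<dyad M}" using finite_subset_dyad[OF assms] .
  let ?D = "{..<dyad M}"
  define b where "b = (\<lambda>l. if l \<in> range dyad then 0 else e' l f)"
  have "L2_set (\<lambda>j. norm (rest j f)) F \<le> L2_set (\<lambda>j. norm (rest j f)) ?D"
    by (intro L2_set_subset_le M) simp
  also have "\<dots> = L2_set (\<lambda>j. norm (\<Sum>l\<in>?D. of_real (hmat l j) * b l)) ?D"
  proof (rule L2_set_cong[OF refl])
    fix j assume "j \<in> ?D"
    then have "rest j f = (\<Sum>l\<in>?D. of_real (hmat l j) * b l)"
      by (subst rest_eq[of j M]) (auto simp: b_def hmat_commute[of j] intro!: sum.mono_neutral_cong_left)
    then show "norm (rest j f) = norm (\<Sum>l\<in>?D. of_real (hmat l j) * b l)" by simp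
  qed
  also have "\<dots> = L2_set (\<lambda>l. norm (b l)) ?D" by (rule hmat_isometry)
  also have "\<dots> = L2_set (\<lambda>l. norm (e' l f)) (?D - range dyad)"
    unfolding L2_set_def b_def by (intro arg_cong[where f = sqrt] sum.mono_neutral_cong_right) auto
  also have "\<dots> \<le> K * norm f" by (intro bessel_e) simp
  finally show ?thesis .
qed

text \<open>The \<open>U (g n)\<close> parts are added by the triangle inequality, whose weights are
  of order (j + 1) ^ (-1/2). What is left combines the \<open>e l\<close> with rotated coefficients,
  whose l2 norm is at most that of \<open>b\<close>.\<close>

lemma z_upper:
  assumes "finite F" "KU > 0" "\<And>f. norm (U f) \<le> KU * norm f"
  shows "norm (\<Sum>j\<in>F. smul (b j) (z j)) \<le>
    (2 * KU * K + K) * ((\<Sum>j\<in>F. norm (b j) / sqrt (real j + 1)) + L2_set (\<lambda>j. norm (b j)) F)"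
proof -
  obtain M where M: "F \<subseteq> {..<dyad M}" using finite_subset_dyad[OF assms(1)] .
  let ?D = "{..<dyad M}"
  let ?s = "\<Sum>j\<in>F. norm (b j) / sqrt (real j + 1)" and ?l = "L2_set (\<lambda>j. norm (b j)) F"
  define b0 where "b0 = (\<lambda>j. if j \<in> F then b j else 0)"
  define \<beta> where "\<beta> = (\<lambda>l. \<Sum>j\<in>?D. of_real (hmat j l) * b0 j)"
  have "(\<Sum>j\<in>F. smul (b j) (z j)) = (\<Sum>j\<in>F. smul (b j) (weight j *\<^sub>R U (g (level j)))) +
      (\<Sum>j\<in>F. \<Sum>l\<in>?D - range dyad. smul (of_real (hmat j l) * b j) (e l))"
    using M by (subst sum.distrib[symmetric], intro sum.cong refl, subst z_split(1)[of _ M])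
      (auto simp: smul.add_right smul.sum_right smul.scaleR_right smul.scaleR_left simp flip: scaleR_conv_of_real)
  also have "(\<Sum>j\<in>F. \<Sum>l\<in>?D - range dyad. smul (of_real (hmat j l) * b j) (e l)) =
      (\<Sum>l\<in>?D - range dyad. smul (\<beta> l) (e l))"
  proof (subst sum.swap, intro sum.cong refl)
    fix l
    have "\<beta> l = (\<Sum>j\<in>F. of_real (hmat j l) * b j)"
      unfolding \<beta>_def b0_def using M by (intro sum.mono_neutral_cong_right) auto
    then show "(\<Sum>j\<in>F. smul (of_real (hmat j l) * b j) (e l)) = smul (\<beta> l) (e l)"
      by (simp add: smul.sum_left)
  qed
  finally have eq: "(\<Sum>j\<in>F. smul (b j) (z j)) = (\<Sum>j\<in>F. smul (b j) (weight j *\<^sub>R U (g (level j)))) +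
      (\<Sum>l\<in>?D - range dyad. smul (\<beta> l) (e l))" .
  have "norm (\<Sum>j\<in>F. smul (b j) (weight j *\<^sub>R U (g (level j)))) \<le>
      (\<Sum>j\<in>F. (2 * KU * K) * (norm (b j) / sqrt (real j + 1)))"
  proof (rule sum_norm_le)
    fix j
    have "norm (U (g (level j))) \<le> KU * K"
      using assms(3)[of "g (level j)"] g_le[of "level j"] assms(2) by (meson mult_left_mono less_imp_le order_trans)
    then have "weight j * norm (U (g (level j))) \<le> 2 / sqrt (real j + 1) * (KU * K)"
      using weight_le[of j] weight_pos[of j] by (intro mult_mono) auto
    then have "norm (b j) * (weight j * norm (U (g (level j)))) \<le> norm (b j) * (2 / sqrt (real j + 1) * (KU * K))"
      by (intro mult_left_mono) auto
    then show "norm (smul (b j) (weight j *\<^sub>R U (g (level j)))) \<le> (2 * KU * K) * (norm (b j) / sqrt (real j + 1))"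
      using weight_pos[of j] by (simp add: norm_smul mult_ac)
  qed
  then have 1: "norm (\<Sum>j\<in>F. smul (b j) (weight j *\<^sub>R U (g (level j)))) \<le> 2 * KU * K * ?s"
    by (simp add: sum_distrib_left)
  have "norm (\<Sum>l\<in>?D - range dyad. smul (\<beta> l) (e l)) \<le> K * L2_set (\<lambda>l. norm (\<beta> l)) (?D - range dyad)"
    by (rule upper_e) simp
  also have "L2_set (\<lambda>l. norm (\<beta> l)) (?D - range dyad) \<le> L2_set (\<lambda>l. norm (\<beta> l)) ?D"
    by (rule L2_set_subset_le) auto
  also have "L2_set (\<lambda>l. norm (\<beta> l)) ?D = L2_set (\<lambda>j. norm (b0 j)) ?D"
    unfolding \<beta>_def by (rule hmat_isometry)
  also have "\<dots> = ?l"
    unfolding L2_set_def b0_def using M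
    by (intro arg_cong[where f = sqrt] sum.mono_neutral_cong_right) auto
  finally have 2: "norm (\<Sum>l\<in>?D - range dyad. smul (\<beta> l) (e l)) \<le> K * ?l" using K1 by simp
  have s0: "?s \<ge> 0" by (intro sum_nonneg) auto
  have "norm (\<Sum>j\<in>F. smul (b j) (z j)) \<le> 2 * KU * K * ?s + K * ?l"
    unfolding eq using 1 2 by (rule norm_triangle_le[OF add_mono])
  also have "\<dots> \<le> (2 * KU * K + K) * (?s + ?l)"
    using s0 K1 assms(2) by (simp add: algebra_simps)
  finally show ?thesis .
qed

text \<open>The estimates come first, with constant \<open>C\<close>, because
  \<open>projection_bound\<close> controls the incomplete block in a partial sum; the constant is
  then enlarged to cover the basis constant.\<close>

theorem z_dkk_basis: "\<exists>C. dkk_basis smul z z' rest C"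
proof -
  obtain KU where KU: "KU > 0" "\<And>f. norm (U f) \<le> KU * norm f" using bop_pos_bound[OF bop_U] by blast
  obtain KQ where KQ: "KQ > 0" "\<And>f. norm (Q f) \<le> KQ * norm f" using bop_pos_bound[OF bop_Q] by blast
  define C where "C = 2 * KU * K + K + 2 * K * KQ"
  have K0: "K > 0" using K1 by simp
  have C: "C \<ge> 1" "2 * KU * K + K \<le> C" "K \<le> C" "2 * K * KQ \<le> C"
  proof -
    have "2 * KU * K > 0" "2 * K * KQ > 0" using K0 KU(1) KQ(1) by simp_all
    then show "C \<ge> 1" "2 * KU * K + K \<le> C" "K \<le> C" "2 * K * KQ \<le> C"
      unfolding C_def using K1 by linarith+
  qed
  have est: "dkk_estimates smul z z' rest C"
  proof
    show "C \<ge> 1" by (rule C)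
    show "norm (\<Sum>j\<in>F. smul (b j) (z j)) \<le>
        C * ((\<Sum>j\<in>F. norm (b j) / sqrt (real j + 1)) + L2_set (\<lambda>j. norm (b j)) F)" if "finite F" for F b
      by (rule order_trans[OF z_upper[OF that KU]], rule mult_right_mono)
        (auto intro!: C add_nonneg_nonneg sum_nonneg)
    show "L2_set (\<lambda>j. norm (rest j f)) F \<le> C * norm f" if "finite F" for F f
      by (rule order_trans[OF rest_bessel[OF that]]) (intro mult_right_mono C norm_ge_zero)
    show "norm (z' j f - rest j f) \<le> C * norm f / sqrt (real j + 1)" for j f
    proof -
      have j: "j < dyad (Suc (level j))" by (rule level_bounds)
      have "norm (g' (level j) (Q f)) \<le> K * (KQ * norm f)"
        using g'_le[of "level j" "Q f"] KQ(2)[of f] K0 by (meson mult_left_mono less_imp_le order_trans)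
      then have "weight j * norm (g' (level j) (Q f)) \<le> 2 / sqrt (real j + 1) * (K * (KQ * norm f))"
        using weight_le[of j] weight_pos[of j] by (intro mult_mono) auto
      also have "\<dots> = 2 * K * KQ * norm f / sqrt (real j + 1)" by simp
      also have "\<dots> \<le> C * norm f / sqrt (real j + 1)"
        by (intro divide_right_mono mult_right_mono C) auto
      finally show ?thesis
        using weight_pos[of j] by (simp add: z_split(2)[OF j] norm_mult)
    qed
  qed
  interpret dkk_estimates smul z z' rest C by (rule est)
  define C' where "C' = C + KU * K * KQ + K * K + 4 * C\<^sup>2"
  have p: "KU * K * KQ \<ge> 0" "K * K \<ge> 0" "C\<^sup>2 \<ge> 0" using KU KQ K0 by auto
  have CC: "C \<le> C'" using p unfolding C'_def by linarith
  have bb: "bounded_basis z z' C'"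
  proof (rule bounded_basisI[OF z_biorth])
    fix n f
    define s where "s = level n"
    have s: "dyad s \<le> n" "n < dyad (Suc s)" unfolding s_def by (rule level_bounds)+
    let ?h = "\<lambda>j. smul (z' j f) (z j)"
    have "(\<Sum>j<n. ?h j) = (\<Sum>j<dyad s. ?h j) + (\<Sum>j\<in>{dyad s..<n}. ?h j)"
      using sum.atLeastLessThan_concat[of 0 "dyad s" n ?h] s(1) by (simp add: atLeast0LessThan)
    moreover have "norm (\<Sum>j<dyad s. ?h j) \<le> KU * K * KQ * norm f + K * K * norm f"
    proof -
      have "norm (\<Sum>n<s. smul (g' n (Q f)) (g n)) \<le> K * norm (Q f)"
        using g_basis by (auto simp: bounded_basis_def)
      also have "\<dots> \<le> K * (KQ * norm f)" using KQ K0 by (intro mult_left_mono) auto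
      finally have "norm (U (\<Sum>n<s. smul (g' n (Q f)) (g n))) \<le> KU * (K * (KQ * norm f))"
        using KU by (meson mult_left_mono less_imp_le order_trans)
      then show ?thesis
        unfolding z_block_sum w_sum_split
        by (intro norm_triangle_le add_mono complement_le) simp
    qed
    moreover have "norm (\<Sum>j\<in>{dyad s..<n}. ?h j) \<le> 4 * C\<^sup>2 * norm f"
    proof -
      \<comment> \<open>Block \<open>s\<close> has \<open>2 ^ s\<close> indices, all with j + 1 at
        least \<open>2 ^ s\<close>, so its harmonic sum is at most 1.\<close>
      have "(\<Sum>j\<in>{dyad s..<n}. 1 / (real j + 1)) \<le> (\<Sum>j\<in>{dyad s..<n}. 1 / 2 ^ s)"
      proof (rule sum_mono)
        fix j assume "j \<in> {dyad s..<n}"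
        then have "(2::nat) ^ s \<le> j + 1" by (auto simp: dyad_def)
        then have "real (2 ^ s) \<le> real (j + 1)" by (simp only: of_nat_le_iff)
        then show "1 / (real j + 1) \<le> 1 / 2 ^ s" by (intro divide_left_mono) auto
      qed
      also have "\<dots> = real (n - dyad s) / 2 ^ s" by simp
      also have "\<dots> \<le> 1"
      proof -
        have "n - dyad s \<le> 2 ^ s" using s by (simp add: dyad_Suc)
        then have "real (n - dyad s) \<le> real (2 ^ s)" by (simp only: of_nat_le_iff)
        then show ?thesis by simp
      qed
      finally have "2 * C\<^sup>2 * (1 + (\<Sum>j\<in>{dyad s..<n}. 1 / (real j + 1))) * norm f \<le> 2 * C\<^sup>2 * (1 + 1) * norm f"
        by (intro mult_right_mono mult_left_mono add_mono) auto
      also have "\<dots> = 4 * C\<^sup>2 * norm f" by simp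
      finally show ?thesis by (rule order_trans[OF projection_bound[OF finite_atLeastLessThan]])
    qed
    ultimately have "norm (\<Sum>j<n. ?h j) \<le> KU * K * KQ * norm f + K * K * norm f + 4 * C\<^sup>2 * norm f"
      using norm_triangle_ineq[of "\<Sum>j<dyad s. ?h j" "\<Sum>j\<in>{dyad s..<n}. ?h j"] by simp
    also have "\<dots> \<le> C' * norm f" using C(1) by (simp add: C'_def algebra_simps)
    finally show "norm (\<Sum>j<n. ?h j) \<le> C' * norm f" .
  next
    fix f and d :: real assume d: "d > 0"
    then obtain M where "norm ((\<Sum>j<dyad M. smul (z' j f) (z j)) - f) < d"
      using LIMSEQ_D[OF z_block_sum_tendsto d] by blast
    then show "\<exists>n. norm ((\<Sum>k<n. smul (z' k f) (z k)) - f) < d" by blast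
  qed
  have "dkk_basis smul z z' rest C'"
  proof (unfold_locales)
    show "C' \<ge> 1" using C CC by linarith
    show "norm (\<Sum>j\<in>F. smul (b j) (z j)) \<le>
        C' * ((\<Sum>j\<in>F. norm (b j) / sqrt (real j + 1)) + L2_set (\<lambda>j. norm (b j)) F)" if "finite F" for F b
      by (rule order_trans[OF upper[OF that]], rule mult_right_mono)
        (auto intro!: CC add_nonneg_nonneg sum_nonneg)
    show "L2_set (\<lambda>j. norm (rest j f)) F \<le> C' * norm f" if "finite F" for F f
      by (rule order_trans[OF bessel[OF that]]) (intro mult_right_mono CC norm_ge_zero)
    show "norm (z' j f - rest j f) \<le> C' * norm f / sqrt (real j + 1)" for j f
      by (rule order_trans[OF average]) (auto intro!: divide_right_mono mult_right_mono CC)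
  qed (rule bb)
  then show ?thesis by blast
qed

text \<open>The vector \<open>U (g n)\<close> is the normalized sum of the \<open>n\<close>-th block of \<open>z\<close>; projecting
  \<open>U (\<Sum>n\<in>W. g n)\<close> onto the blocks in \<open>V\<close> therefore gives \<open>U (\<Sum>n\<in>V. g n)\<close>.\<close>

lemma z'_U_sum:
  assumes "finite W"
  shows "z' j (U (\<Sum>n\<in>W. g n)) = (if level j \<in> W then of_real (weight j) else 0)"
proof -
  have "U (\<Sum>n\<in>W. g n) = (\<Sum>n\<in>W. w (dyad n))" by (simp add: bop_lin[OF bop_U] w_def)
  then have "z' j (U (\<Sum>n\<in>W. g n)) = (\<Sum>n\<in>W. if level j = n then of_real (weight j) else 0)"
    by (simp add: bfun_lin[OF bfun_z'] z'_w hmat_dyad if_distrib cong: if_cong)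
  then show ?thesis using assms by simp
qed

lemma U_sum_expansion:
  assumes "V \<subseteq> {..<M}"
  shows "(\<Sum>j<dyad M. smul (z' j (U (\<Sum>n\<in>V. g n))) (z j)) = U (\<Sum>n\<in>V. g n)"
proof -
  have fin: "finite V" using assms finite_subset by blast
  have Usum: "U (\<Sum>n\<in>V. g n) = (\<Sum>n\<in>V. w (dyad n))" by (simp add: bop_lin[OF bop_U] w_def)
  have "w' l (U (\<Sum>n\<in>V. g n)) = (if l \<in> dyad ` V then 1 else 0)" for l
  proof -
    have "w' l (U (\<Sum>n\<in>V. g n)) = (\<Sum>n\<in>V. if l = dyad n then 1 else 0)"
      unfolding Usum by (simp add: bfun_lin[OF bfun_w'] w_biorth)
    also have "\<dots> = (\<Sum>k\<in>dyad ` V. if l = k then 1 else 0)"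
      by (subst sum.reindex) (auto intro: inj_on_subset[OF inj_dyad])
    finally show ?thesis using fin by simp
  qed
  then have "(\<Sum>l<dyad M. smul (w' l (U (\<Sum>n\<in>V. g n))) (w l)) = (\<Sum>l<dyad M. if l \<in> dyad ` V then w l else 0)"
    by (intro sum.cong) auto
  also have "\<dots> = (\<Sum>l\<in>dyad ` V. w l)"
    using assms by (intro sum.mono_neutral_cong_right) (auto simp: less_dyad_iff)
  also have "\<dots> = (\<Sum>n\<in>V. w (dyad n))" by (subst sum.reindex) (auto intro: inj_on_subset[OF inj_dyad])
  finally show ?thesis unfolding z_block_sum Usum .
qed

text \<open>The first \<open>m\<close> indices contain \<open>M\<close>, about log m, complete
  blocks. Projecting onto the blocks with number in \<open>V\<close> turns the image under
  \<open>U\<close> of a bounded window sum over \<open>W\<close> into a vector of norm at least a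
  multiple of \<open>M\<close>.\<close>

theorem conditionality_lower:
  assumes win: "\<And>n. n \<ge> 1 \<Longrightarrow> \<exists>W V. V \<subseteq> W \<and> W \<subseteq> {..<n} \<and> norm (\<Sum>i\<in>W. g i) \<le> K \<and>
      real n \<le> K * norm (\<Sum>i\<in>V. g i)"
  shows "lesssim_on {2..} (\<lambda>m. ennreal (ln (real m))) (w_conditionality smul z)"
proof -
  obtain C where "dkk_basis smul z z' rest C" using z_dkk_basis by blast
  then interpret dkk_basis smul z z' rest C .
  obtain KU where KU: "KU > 0" "\<And>f. norm (U f) \<le> KU * norm f" using bop_pos_bound[OF bop_U] by blast
  obtain KQ where KQ: "KQ > 0" "\<And>f. norm (Q f) \<le> KQ * norm f" using bop_pos_bound[OF bop_Q] by blast
  have K0: "K > 0" using K1 by simp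
  \<comment> \<open>\<open>K * KQ\<close> passes from \<open>real M\<close> to
    \<open>norm h\<close>, \<open>KU * K\<close> bounds \<open>norm f\<close>, and the 2 comes from
    ln m <= 2 M.\<close>
  define B where "B = 2 * K * KQ * KU * K"
  have B: "B > 0" using K0 KQ KU by (simp add: B_def)
  have "ennreal (ln (real m)) \<le> ennreal B * w_conditionality smul z m" if m: "m \<ge> 2" for m
  proof -
    define M where "M = level m"
    have M: "dyad M \<le> m" "m < dyad (Suc M)" unfolding M_def by (rule level_bounds)+
    have M1: "M \<ge> 1" using M m by (cases M) (auto simp: dyad_def)
    obtain W V where WV: "V \<subseteq> W" "W \<subseteq> {..<M}" "norm (\<Sum>i\<in>W. g i) \<le> K" "real M \<le> K * norm (\<Sum>i\<in>V. g i)"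
      using win[OF M1] by blast
    have finW: "finite W" and finV: "finite V"
      using WV(1,2) by (meson finite_lessThan finite_subset)+
    define f where "f = U (\<Sum>n\<in>W. g n)"
    define h where "h = U (\<Sum>n\<in>V. g n)"
    define A where "A = {j. level j \<in> V}"
    have cf: "z' j f = (if level j \<in> W then of_real (weight j) else 0)" for j
      unfolding f_def by (rule z'_U_sum[OF finW])
    have supp: "basis_supp smul z f \<subseteq> {..<m}"
    proof
      fix j assume "j \<in> basis_supp smul z f"
      then have "level j \<in> W" by (auto simp: basis_supp_def coord_eq cf split: if_splits)
      then have "j < dyad M" using WV by (auto simp: less_dyad_iff)
      then show "j \<in> {..<m}" using M by simp
    qed
    have proj: "coord_proj smul z A f = h"
    proof -
      have AM: "A \<subseteq> {..<dyad M}" using WV by (auto simp: A_def less_dyad_iff)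
      then have "coord_proj smul z A f = (\<Sum>j\<in>A. smul (z' j f) (z j))"
        by (intro coord_proj_finite finite_subset[OF AM]) auto
      also have "\<dots> = (\<Sum>j<dyad M. smul (z' j h) (z j))"
        using AM WV(1) by (intro sum.mono_neutral_cong_left) (auto simp: A_def cf h_def z'_U_sum[OF finV])
      also have "\<dots> = h" unfolding h_def using WV by (intro U_sum_expansion) auto
      finally show ?thesis .
    qed
    have "(\<Sum>n\<in>V. g n) = Q h" by (simp add: h_def unpack_pack[OF inj_dyad])
    then have "norm (\<Sum>n\<in>V. g n) \<le> KQ * norm h" using KQ(2) by metis
    then have Mh: "real M \<le> K * (KQ * norm h)" using WV(4) K0 by (meson mult_left_mono less_imp_le order_trans)
    have hn: "h \<noteq> 0"
    proof
      assume "h = 0"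
      then show False using Mh M1 by simp
    qed
    have f0: "f \<noteq> 0"
    proof
      assume "f = 0"
      then have "coord_proj smul z A f = 0" 
        using coord_proj_finite[of "{}" A f] by (simp add: bfun_lin[OF bfun_z'])
      then show False using proj hn by simp
    qed
    have "norm f \<le> KU * K" unfolding f_def using KU WV(3) by (meson mult_left_mono less_imp_le order_trans)
    then have "norm f * (norm h / norm f) \<le> (KU * K) * (norm h / norm f)"
      by (intro mult_right_mono) auto
    then have "norm h \<le> (KU * K) * (norm h / norm f)" using f0 by simp
    then have "K * (KQ * norm h) \<le> K * (KQ * ((KU * K) * (norm h / norm f)))"
      using K0 KQ by (intro mult_left_mono) auto
    then have "2 * real M \<le> B * (norm h / norm f)" using Mh by (simp add: B_def)
    moreover have "ln (real m) \<le> 2 * real M"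
    proof -
      have "m \<le> 2 ^ Suc M" using M(2) by (simp add: dyad_def)
      then have "real m \<le> real (2 ^ Suc M)" by (simp only: of_nat_le_iff)
      then have "ln (real m) \<le> ln (2 ^ Suc M)" using m by simp
      also have "\<dots> = (real M + 1) * ln 2" by (simp add: ln_realpow del: power_Suc)
      also have "\<dots> \<le> (real M + 1) * 1" using ln_2_less_1 by (intro mult_left_mono) auto
      finally show ?thesis using M1 by simp
    qed
    ultimately have "ennreal (ln (real m)) \<le> ennreal (B * (norm h / norm f))" by (intro ennreal_leI) linarith
    also have "\<dots> = ennreal B * ennreal (norm h / norm f)" using B by (intro ennreal_mult) auto
    also have "ennreal (norm h / norm f) \<le> w_conditionality smul z m"
      unfolding w_conditionality_def
      by (rule SUP_upper2[of "(f, A)"]) (use f0 supp proj in auto)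
    finally show ?thesis by (simp add: mult_left_mono)
  qed
  then show ?thesis unfolding lesssim_on_def by auto
qed

end

section \<open>The basis for a general scalar field and its real and complex instances\<close>

context scalar_banach
begin

theorem highly_conditional_almost_greedy_basis:
  assumes "\<exists>x. schauder_basis smul x \<and> type_P x"
    and "\<exists>Y. complemented_subspace smul Y \<and> l2_isomorphic_to smul Y"
  shows "\<exists>x. schauder_basis smul x \<and> almost_greedy smul x \<and>
    approx_on {1..} (fundamental_fun x) (\<lambda>m. ennreal (real m powr (1/2))) \<and>
    approx_on {2..} (w_conditionality smul x) (\<lambda>m. ennreal (ln (real m)))"
proof -
  obtain x where x: "schauder_basis smul x" "type_P x" using assms(1) by blast
  obtain Y where Y: "complemented_subspace smul Y" "l2_isomorphic_to smul Y" using assms(2) by blast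
  obtain g g' K where g: "bounded_basis g g' K" "K > 0" "\<And>i. norm (g i) \<le> K" "\<And>i f. norm (g' i f) \<le> K * norm f"
    "\<And>n. n \<ge> 1 \<Longrightarrow> \<exists>W V. V \<subseteq> W \<and> W \<subseteq> {..<n} \<and> norm (\<Sum>i\<in>W. g i) \<le> K \<and> real n \<le> K * norm (\<Sum>i\<in>V. g i)"
    by (rule type_P_conditional_basis[OF x]) (rule that)
  obtain e e' L where "hilbert_system smul e e' L" using l2_complemented_hilbert_system[OF Y] .
  then interpret hs: hilbert_system smul e e' L .
  define B where "B = K + L"
  have B: "K \<le> B" "L \<le> B" "B \<ge> 1" using g(2) hs.K1 by (auto simp: B_def)
  have up: "u \<le> B * r" if "u \<le> C * r" "C \<le> B" "r \<ge> 0" for u C r :: real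
    using that by (meson mult_right_mono order_trans)
  interpret dkk_construction smul e e' B g g'
  proof
    show "bounded_basis g g' B"
      unfolding bounded_basis_def
    proof (intro conjI allI)
      show "norm (\<Sum>k<n. smul (g' k f) (g k)) \<le> B * norm f" for n f
        by (rule up[OF _ B(1) norm_ge_zero]) (use g(1) in \<open>simp add: bounded_basis_def\<close>)
    qed (use g(1) in \<open>simp_all add: bounded_basis_def\<close>)
    show "norm (g n) \<le> B" for n using g(3)[of n] B(1) by linarith
    show "norm (g' n f) \<le> B * norm f" for n f by (rule up[OF g(4) B(1) norm_ge_zero])
    show "L2_set (\<lambda>k. norm (e' k f)) F \<le> B * norm f" if "finite F" for F f
      by (rule up[OF hs.bessel_e[OF that] B(2) norm_ge_zero])
    show "norm (\<Sum>k\<in>F. smul (b k) (e k)) \<le> B * L2_set (\<lambda>k. norm (b k)) F" if "finite F" for F b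
      by (rule up[OF hs.upper_e[OF that] B(2) L2_set_nonneg])
  qed (rule B hs.biorth_e)+
  obtain C where "dkk_basis smul z z' rest C" using z_dkk_basis by blast
  then interpret db: dkk_basis smul z z' rest C .
  have "\<exists>W V. V \<subseteq> W \<and> W \<subseteq> {..<n} \<and> norm (\<Sum>i\<in>W. g i) \<le> B \<and> real n \<le> B * norm (\<Sum>i\<in>V. g i)"
    if n: "n \<ge> 1" for n
  proof -
    obtain W V where "V \<subseteq> W" "W \<subseteq> {..<n}" "norm (\<Sum>i\<in>W. g i) \<le> K" "real n \<le> K * norm (\<Sum>i\<in>V. g i)"
      using g(5)[OF n] by blast
    then show ?thesis using up[OF _ B(1) norm_ge_zero] B(1) by (intro exI[of _ W] exI[of _ V]) auto
  qed
  then show ?thesis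
    using bounded_basis_schauder(1)[OF db.basis] db.almost_greedy db.fundamental
      db.conditionality_upper conditionality_lower
    by (intro exI[of _ z]) (simp add: approx_on_def)
qed

end

theorem theorem3p5:
  fixes scaleC :: "complex \<Rightarrow> 'b::banach \<Rightarrow> 'b"
  shows
    "((\<exists>x :: nat \<Rightarrow> 'a::banach. schauder_basis scaleR x \<and> type_P x) \<longrightarrow>
      (\<exists>Y :: 'a set. complemented_subspace scaleR Y \<and> l2_isomorphic_to scaleR Y) \<longrightarrow>
      (\<exists>x :: nat \<Rightarrow> 'a. schauder_basis scaleR x \<and> almost_greedy scaleR x \<and>
         approx_on {1..} (fundamental_fun x) (\<lambda>m. ennreal (real m powr (1/2))) \<and>
         approx_on {2..} (w_conditionality scaleR x) (\<lambda>m. ennreal (ln (real m)))))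
     \<and>
     (banach_space_over scaleC \<longrightarrow>
      (\<exists>x. schauder_basis scaleC x \<and> type_P x) \<longrightarrow>
      (\<exists>Y. complemented_subspace scaleC Y \<and> l2_isomorphic_to scaleC Y) \<longrightarrow>
      (\<exists>x. schauder_basis scaleC x \<and> almost_greedy scaleC x \<and>
         approx_on {1..} (fundamental_fun x) (\<lambda>m. ennreal (real m powr (1/2))) \<and>
         approx_on {2..} (w_conditionality scaleC x) (\<lambda>m. ennreal (ln (real m)))))"
proof (intro conjI impI)
  have "scalar_banach (scaleR :: real \<Rightarrow> 'a \<Rightarrow> 'a)"
    by (rule scalar_banach.intro[OF banach_space_over_scaleR])
  note real = scalar_banach.highly_conditional_almost_greedy_basis[OF this]
  assume "\<exists>x :: nat \<Rightarrow> 'a. schauder_basis scaleR x \<and> type_P x"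
    and "\<exists>Y :: 'a set. complemented_subspace scaleR Y \<and> l2_isomorphic_to scaleR Y"
  then show "\<exists>x :: nat \<Rightarrow> 'a. schauder_basis scaleR x \<and> almost_greedy scaleR x \<and>
         approx_on {1..} (fundamental_fun x) (\<lambda>m. ennreal (real m powr (1/2))) \<and>
         approx_on {2..} (w_conditionality scaleR x) (\<lambda>m. ennreal (ln (real m)))"
    by (rule real)
next
  assume "banach_space_over scaleC"
  note complex = scalar_banach.highly_conditional_almost_greedy_basis[OF scalar_banach.intro[OF this]]
  assume "\<exists>x. schauder_basis scaleC x \<and> type_P x"
    and "\<exists>Y. complemented_subspace scaleC Y \<and> l2_isomorphic_to scaleC Y"
  then show "\<exists>x. schauder_basis scaleC x \<and> almost_greedy scaleC x \<and>
         approx_on {1..} (fundamental_fun x) (\<lambda>m. ennreal (real m powr (1/2))) \<and>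
         approx_on {2..} (w_conditionality scaleC x) (\<lambda>m. ennreal (ln (real m)))"
    by (rule complex)
qed

end
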